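(* Let $R$ be a prime noetherian algebra over a field $k$ and let $N$ be a proper invertible ideal of $R$. If $\dim_k(R/N)<\infty$, then $R$ is a PI ring.
   Context: Rings are associative with $1$, and a $k$-algebra has $k$ acting centrally; ideals are two-sided; "noetherian" means left and right noetherian. For a prime noetherian ring $R$ with Goldie (classical) quotient ring $Q=Q(R)$, an ideal $I$ of $R$ is invertible if there is an $R$-subbimodule $I^{-1}$ of $Q$ with $II^{-1}=I^{-1}I=R$. Proper means different from $R$. A PI ring is a ring satisfying a polynomial identity (a polynomial in noncommuting variables with integer coefficients, at least one of whose monomials of highest degree has coefficient $1$, that vanishes under all substitutions of elements of the ring). *)

theory Defs
  imports "HOL-Algebra.Algebra" "HOL-Library.Poly_Mapping"
begin

text \<open>
  The library locale \<^locale>\<open>algebra\<close> forces the algebra itself to be commutative, so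
  associative algebras over a field need their own locale.
\<close>

locale assoc_algebra = K?: field k + module k R + A?: ring R
  for k :: "('c, 'm) ring_scheme" and R :: "('c, 'a, 'n) module_scheme" (structure) +
  assumes smult_mult_left:
      "\<lbrakk>c \<in> carrier k; x \<in> carrier R; y \<in> carrier R\<rbrakk>
        \<Longrightarrow> (c \<odot>\<^bsub>R\<^esub> x) \<otimes>\<^bsub>R\<^esub> y = c \<odot>\<^bsub>R\<^esub> (x \<otimes>\<^bsub>R\<^esub> y)"
    and smult_mult_right:
      "\<lbrakk>c \<in> carrier k; x \<in> carrier R; y \<in> carrier R\<rbrakk>
        \<Longrightarrow> x \<otimes>\<^bsub>R\<^esub> (c \<odot>\<^bsub>R\<^esub> y) = c \<odot>\<^bsub>R\<^esub> (x \<otimes>\<^bsub>R\<^esub> y)"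

definition left_ideal :: "'a set \<Rightarrow> ('a, 'm) ring_scheme \<Rightarrow> bool" where
  "left_ideal I R \<longleftrightarrow>
     additive_subgroup I R \<and> (\<forall>r\<in>carrier R. \<forall>x\<in>I. r \<otimes>\<^bsub>R\<^esub> x \<in> I)"

definition right_ideal :: "'a set \<Rightarrow> ('a, 'm) ring_scheme \<Rightarrow> bool" where
  "right_ideal I R \<longleftrightarrow>
     additive_subgroup I R \<and> (\<forall>r\<in>carrier R. \<forall>x\<in>I. x \<otimes>\<^bsub>R\<^esub> r \<in> I)"

text \<open>
  The library locale \<^locale>\<open>noetherian_ring\<close> only constrains two-sided ideals, hence the
  following one-sided chain conditions.
\<close>

definition left_noetherian :: "('a, 'm) ring_scheme \<Rightarrow> bool" where
  "left_noetherian R \<longleftrightarrow>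
     (\<forall>I :: nat \<Rightarrow> 'a set.
        (\<forall>n. left_ideal (I n) R) \<and> (\<forall>n. I n \<subseteq> I (Suc n)) \<longrightarrow> (\<exists>m. \<forall>n\<ge>m. I n = I m))"

definition right_noetherian :: "('a, 'm) ring_scheme \<Rightarrow> bool" where
  "right_noetherian R \<longleftrightarrow>
     (\<forall>I :: nat \<Rightarrow> 'a set.
        (\<forall>n. right_ideal (I n) R) \<and> (\<forall>n. I n \<subseteq> I (Suc n)) \<longrightarrow> (\<exists>m. \<forall>n\<ge>m. I n = I m))"

text \<open>
  Primeness is expressed through products of two-sided ideals; the library locale
  \<^locale>\<open>primeideal\<close> is elementwise and restricted to commutative rings.
\<close>

definition prime_ring :: "('a, 'm) ring_scheme \<Rightarrow> bool" where
  "prime_ring R \<longleftrightarrow>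
     ring R \<and> \<one>\<^bsub>R\<^esub> \<noteq> \<zero>\<^bsub>R\<^esub> \<and>
     (\<forall>I J. ideal I R \<and> ideal J R \<and> I \<cdot>\<^bsub>R\<^esub> J = {\<zero>\<^bsub>R\<^esub>}
        \<longrightarrow> I = {\<zero>\<^bsub>R\<^esub>} \<or> J = {\<zero>\<^bsub>R\<^esub>})"

definition regular_element :: "('a, 'm) ring_scheme \<Rightarrow> 'a \<Rightarrow> bool" where
  "regular_element R s \<longleftrightarrow>
     s \<in> carrier R \<and>
     (\<forall>r\<in>carrier R. s \<otimes>\<^bsub>R\<^esub> r = \<zero>\<^bsub>R\<^esub> \<longrightarrow> r = \<zero>\<^bsub>R\<^esub>) \<and>
     (\<forall>r\<in>carrier R. r \<otimes>\<^bsub>R\<^esub> s = \<zero>\<^bsub>R\<^esub> \<longrightarrow> r = \<zero>\<^bsub>R\<^esub>)"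

text \<open>
  \<open>Q\<close> together with the embedding \<open>\<iota>\<close> is a two-sided classical quotient ring of \<open>R\<close>.  It is
  determined by \<open>R\<close> up to a unique isomorphism over \<open>R\<close>; for prime noetherian \<open>R\<close> it exists by
  Goldie's theorem.
\<close>

definition classical_quotient_ring ::
    "('a, 'm) ring_scheme \<Rightarrow> ('b, 'n) ring_scheme \<Rightarrow> ('a \<Rightarrow> 'b) \<Rightarrow> bool" where
  "classical_quotient_ring R Q \<iota> \<longleftrightarrow>
     ring R \<and> ring Q \<and> \<iota> \<in> ring_hom R Q \<and> inj_on \<iota> (carrier R) \<and>
     (\<forall>s. regular_element R s \<longrightarrow> \<iota> s \<in> Units Q) \<and>
     (\<forall>q\<in>carrier Q. \<exists>r\<in>carrier R. \<exists>s. regular_element R s \<and> q = \<iota> r \<otimes>\<^bsub>Q\<^esub> inv\<^bsub>Q\<^esub> (\<iota> s)) \<and>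
     (\<forall>q\<in>carrier Q. \<exists>r\<in>carrier R. \<exists>s. regular_element R s \<and> q = inv\<^bsub>Q\<^esub> (\<iota> s) \<otimes>\<^bsub>Q\<^esub> \<iota> r)"

definition subbimodule ::
    "('a, 'm) ring_scheme \<Rightarrow> ('b, 'n) ring_scheme \<Rightarrow> ('a \<Rightarrow> 'b) \<Rightarrow> 'b set \<Rightarrow> bool" where
  "subbimodule R Q \<iota> J \<longleftrightarrow>
     additive_subgroup J Q \<and>
     (\<forall>r\<in>carrier R. \<forall>x\<in>J. \<iota> r \<otimes>\<^bsub>Q\<^esub> x \<in> J \<and> x \<otimes>\<^bsub>Q\<^esub> \<iota> r \<in> J)"

text \<open>
  The set \<open>ideal_prod Q A B\<close> consists of the finite nonempty sums of products of an element of
  \<open>A\<close> and an element of \<open>B\<close>.  When \<open>A\<close> and \<open>B\<close> are additive subgroups of \<open>Q\<close>, this is the usual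
  product of additive subgroups, whether or not they are ideals of \<open>Q\<close>.
\<close>

definition invertible_ideal ::
    "('a, 'm) ring_scheme \<Rightarrow> ('b, 'n) ring_scheme \<Rightarrow> ('a \<Rightarrow> 'b) \<Rightarrow> 'a set \<Rightarrow> bool" where
  "invertible_ideal R Q \<iota> I \<longleftrightarrow>
     ideal I R \<and>
     (\<exists>J. subbimodule R Q \<iota> J \<and>
          (\<iota> ` I) \<cdot>\<^bsub>Q\<^esub> J = \<iota> ` carrier R \<and>
          J \<cdot>\<^bsub>Q\<^esub> (\<iota> ` I) = \<iota> ` carrier R)"

text \<open>
  The scalar \<open>c\<close> acts on \<open>R / N\<close> as multiplication by the coset of \<open>c \<odot> \<one>\<close>, so the
  \<open>k\<close>-vector space structure of \<open>R / N\<close> is the one over the image of \<open>k\<close> in \<open>R / N\<close> (see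
  \<open>scalars_mod_mult\<close> and \<open>subfield_scalars_mod\<close> below).  This is the form
  required by the library notion of dimension, which takes scalars from a subfield of the ring.
\<close>

definition scalars_mod ::
    "('c, 'm) ring_scheme \<Rightarrow> ('c, 'a, 'n) module_scheme \<Rightarrow> 'a set \<Rightarrow> 'a set set" where
  "scalars_mod k R N = (\<lambda>c. N +>\<^bsub>R\<^esub> (c \<odot>\<^bsub>R\<^esub> \<one>\<^bsub>R\<^esub>)) ` carrier k"

definition finite_codimension ::
    "('c, 'm) ring_scheme \<Rightarrow> ('c, 'a, 'n) module_scheme \<Rightarrow> 'a set \<Rightarrow> bool" where
  "finite_codimension k R N \<longleftrightarrow>
     ring.finite_dimension (R Quot N) (scalars_mod k R N) (carrier (R Quot N))"

lemma (in assoc_algebra) scalars_mod_mult: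
  assumes "ideal N R" "c \<in> carrier k" "x \<in> carrier R"
  shows "(N +> (c \<odot> \<one>)) \<otimes>\<^bsub>R Quot N\<^esub> (N +> x) = N +> (c \<odot> x)"
  using ideal.rcoset_mult_add[OF assms(1), of "c \<odot> \<one>" x] assms
  by (simp add: FactRing_def smult_mult_left)

lemma (in assoc_algebra) subfield_scalars_mod:
  assumes N: "ideal N R" and proper: "N \<noteq> carrier R"
  shows "subfield (scalars_mod k R N) (R Quot N)"
proof -
  interpret N: ideal N R by (rule N)
  interpret RN: ring "R Quot N" by (rule N.quotient_is_ring)
  have h1: "(\<lambda>c. c \<odot> \<one>) \<in> ring_hom k R"
    by (rule ring_hom_memI) (simp_all add: smult_l_distr smult_assoc1 smult_mult_left)
  have h2: "(\<lambda>c. N +> (c \<odot> \<one>)) \<in> ring_hom k (R Quot N)"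
    using ring_hom_trans[OF h1 N.rcos_ring_hom] by (simp add: o_def)
  interpret h: ring_hom_ring k "R Quot N" "\<lambda>c. N +> (c \<odot> \<one>)"
    by (rule ring_hom_ringI2[OF _ RN.ring_axioms h2]) (rule K.ring_axioms)
  have "\<one>\<^bsub>R Quot N\<^esub> \<noteq> \<zero>\<^bsub>R Quot N\<^esub>"
  proof
    assume "\<one>\<^bsub>R Quot N\<^esub> = \<zero>\<^bsub>R Quot N\<^esub>"
    then have "N +> \<one> = N" by (simp add: FactRing_def)
    then have "\<one> \<in> N" using N.a_rcos_self[of \<one>] by simp
    then show False using N.one_imp_carrier proper by blast
  qed
  moreover have "subfield (carrier k) k"
    by (rule K.carrier_is_subfield)
  ultimately show ?thesis
    unfolding scalars_mod_def using h.img_is_subfield(2) by blast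
qed

text \<open>
  A polynomial in the noncommuting variables \<open>x\<^sub>0, x\<^sub>1, \<dots>\<close> with integer coefficients is a finitely
  supported function on words, where the word \<open>[i\<^sub>1, \<dots>, i\<^sub>d]\<close> stands for the monomial
  \<open>x\<^bsub>i\<^sub>1\<^esub> \<cdots> x\<^bsub>i\<^sub>d\<^esub>\<close> of degree \<open>d\<close>.
\<close>

type_synonym nc_poly = "nat list \<Rightarrow>\<^sub>0 int"

definition nc_monom_eval :: "('a, 'm) ring_scheme \<Rightarrow> (nat \<Rightarrow> 'a) \<Rightarrow> nat list \<Rightarrow> 'a" where
  "nc_monom_eval R x w = foldr (\<lambda>i a. x i \<otimes>\<^bsub>R\<^esub> a) w \<one>\<^bsub>R\<^esub>"

definition nc_poly_eval :: "('a, 'm) ring_scheme \<Rightarrow> (nat \<Rightarrow> 'a) \<Rightarrow> nc_poly \<Rightarrow> 'a" where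
  "nc_poly_eval R x p =
     (\<Oplus>\<^bsub>R\<^esub>w\<in>Poly_Mapping.keys p. [Poly_Mapping.lookup p w] \<cdot>\<^bsub>R\<^esub> nc_monom_eval R x w)"

definition PI_ring :: "('a, 'm) ring_scheme \<Rightarrow> bool" where
  "PI_ring R \<longleftrightarrow>
     ring R \<and>
     (\<exists>p :: nc_poly.
        (\<exists>w\<in>Poly_Mapping.keys p. Poly_Mapping.lookup p w = 1 \<and>
           (\<forall>v\<in>Poly_Mapping.keys p. length v \<le> length w)) \<and>
        (\<forall>x. (\<forall>i. x i \<in> carrier R) \<longrightarrow> nc_poly_eval R x p = \<zero>\<^bsub>R\<^esub>))"

end

theory Submission
  imports Defs "HOL-Combinatorics.Permutations"
begin

text \<open>
  Write \<open>1 = \<Sum> c\<^sub>i q\<^sub>i\<close> with \<open>c\<^sub>i \<in> N\<close> and \<open>q\<^sub>i \<in> N\<^bsup>-1\<^esup>\<close>; clearing denominators shows that \<open>N\<close> contains a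
  regular element \<open>x\<close>.  By invertibility of \<open>N\<close>, the factors \<open>N\<^bsup>i\<^esup>/N\<^bsup>i+1\<^esup>\<close> have bounded dimension, the
  Artin-Rees property holds, and \<open>\<Inter>N\<^bsup>n\<^esup> = 0\<close> because \<open>R\<close> is prime.  By Artin-Rees, the kernel of left
  multiplication by \<open>x\<close> on the finite-dimensional space \<open>R/N\<^bsup>n\<^esup>\<close> is contained in \<open>N\<^bsup>n-m\<^esup>/N\<^bsup>n\<^esup>\<close>
  with \<open>m\<close> fixed, so the kernel and the cokernel have dimension bounded independently of \<open>n\<close>.
  As \<open>x\<close> is nilpotent on \<open>R/N\<^bsup>n\<^esup>\<close>, this space is generated by \<open>b\<close> elements as a left \<open>k[x]\<close>-module,
  with \<open>b\<close> independent of \<open>n\<close>.  Right multiplications commute with this commutative action, so every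
  \<open>R/N\<^bsup>n\<^esup>\<close>, and hence \<open>R\<close>, satisfies the standard identity of degree \<open>b\<^sup>2 + 1\<close>.
\<close>

section \<open>Right ideals and powers of an ideal\<close>

text \<open>The obstacle is uniformity in \<open>n\<close>: \<open>dim R/N^n\<close> is bounded only
  linearly in \<open>n\<close>, while one identity for \<open>R\<close> needs a number of generators
  independent of \<open>n\<close>. Since \<open>x\<close> acts from the left, the count runs over
  right ideals; \<open>xR + N^n\<close> need not be two-sided. Two devices replace dimensions:
  spanning lists give upper bounds, and strictly monotone natural-valued ranks on right ideals limit
  the number of steps in a chain, each step adding at most as many generators as span
  \<open>R/N\<close>. The comparison of kernel and cokernel becomes a pigeonhole argument on the
  chain \<open>x^j R + N^n\<close>: its total drop is at most linear in \<open>n\<close>, so one of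
  its steps is small, and cancelling \<open>x^j\<close> carries that step back to
  \<open>R/(xR + N^n0)\<close>. The commutative ring that acts is the image of the double
  centraliser of \<open>x\<close>, which contains the scalars and \<open>x\<close>. The degree
  \<open>b^2 + 1\<close> comes from the \<open>b^2\<close> positions of a \<open>b\<close> by
  \<open>b\<close> matrix: a path of \<open>b^2 + 1\<close> positions uses one of them
  twice.\<close>

no_notation Sum_Type.Plus (infixr \<open><+>\<close> 65)

lemma mem_l_coset_iff: "y \<in> u <#\<^bsub>G\<^esub> A \<longleftrightarrow> (\<exists>a\<in>A. y = u \<otimes>\<^bsub>G\<^esub> a)"
  by (auto simp: l_coset_def)

section \<open>Right ideals, their sums and products\<close>

context ring
begin

lemma right_idealI:
  assumes "I \<subseteq> carrier R" "\<zero> \<in> I"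
    and "\<And>x y. \<lbrakk>x \<in> I; y \<in> I\<rbrakk> \<Longrightarrow> x \<oplus> y \<in> I"
    and "\<And>x r. \<lbrakk>x \<in> I; r \<in> carrier R\<rbrakk> \<Longrightarrow> x \<otimes> r \<in> I"
  shows "right_ideal I R"
proof -
  have "\<ominus> x \<in> I" if "x \<in> I" for x
  proof -
    have "x \<otimes> \<ominus> \<one> = \<ominus> x"
      using that assms(1) by (simp add: r_minus subset_iff)
    then show ?thesis using assms(4)[OF that, of "\<ominus> \<one>"] by simp
  qed
  then have "subgroup I (add_monoid R)"
    using assms by (intro add.subgroupI) (auto simp: a_inv_def)
  then show ?thesis
    using assms by (simp add: right_ideal_def additive_subgroup_def)
qed

lemma left_idealI:
  assumes "I \<subseteq> carrier R" "\<zero> \<in> I"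
    and "\<And>x y. \<lbrakk>x \<in> I; y \<in> I\<rbrakk> \<Longrightarrow> x \<oplus> y \<in> I"
    and "\<And>x r. \<lbrakk>x \<in> I; r \<in> carrier R\<rbrakk> \<Longrightarrow> r \<otimes> x \<in> I"
  shows "left_ideal I R"
proof -
  have "\<ominus> x \<in> I" if "x \<in> I" for x
  proof -
    have "\<ominus> \<one> \<otimes> x = \<ominus> x"
      using that assms(1) by (simp add: l_minus subset_iff)
    then show ?thesis using assms(4)[OF that, of "\<ominus> \<one>"] by simp
  qed
  then have "subgroup I (add_monoid R)"
    using assms by (intro add.subgroupI) (auto simp: a_inv_def)
  then show ?thesis
    using assms by (simp add: left_ideal_def additive_subgroup_def)
qed

lemma right_idealD:
  assumes "right_ideal I R"
  shows "I \<subseteq> carrier R" "\<zero> \<in> I"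
    and "\<And>x y. \<lbrakk>x \<in> I; y \<in> I\<rbrakk> \<Longrightarrow> x \<oplus> y \<in> I"
    and "\<And>x. x \<in> I \<Longrightarrow> \<ominus> x \<in> I"
    and "\<And>x y. \<lbrakk>x \<in> I; y \<in> I\<rbrakk> \<Longrightarrow> x \<ominus> y \<in> I"
    and "\<And>x r. \<lbrakk>x \<in> I; r \<in> carrier R\<rbrakk> \<Longrightarrow> x \<otimes> r \<in> I"
proof -
  have s: "additive_subgroup I R" using assms by (simp add: right_ideal_def)
  then interpret s: additive_subgroup I R .
  show "I \<subseteq> carrier R" "\<zero> \<in> I" by (rule s.a_subset, rule s.zero_closed)
  show "\<And>x y. \<lbrakk>x \<in> I; y \<in> I\<rbrakk> \<Longrightarrow> x \<oplus> y \<in> I" by (rule s.a_closed)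
  show m: "\<And>x. x \<in> I \<Longrightarrow> \<ominus> x \<in> I"
    using s.a_subgroup subgroup.m_inv_closed by (fastforce simp: a_inv_def)
  show "\<And>x y. \<lbrakk>x \<in> I; y \<in> I\<rbrakk> \<Longrightarrow> x \<ominus> y \<in> I"
    using m by (simp add: a_minus_def)
  show "\<And>x r. \<lbrakk>x \<in> I; r \<in> carrier R\<rbrakk> \<Longrightarrow> x \<otimes> r \<in> I"
    using assms by (simp add: right_ideal_def)
qed

lemma right_ideal_of_ideal: "ideal I R \<Longrightarrow> right_ideal I R"
  by (simp add: right_ideal_def ideal.axioms(1) ideal.I_r_closed)

lemma right_ideal_carrier: "right_ideal (carrier R) R"
  by (simp add: right_ideal_of_ideal oneideal)

lemma right_ideal_l_coset:
  assumes "x \<in> carrier R" "right_ideal A R"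
  shows "right_ideal (x <# A) R"
proof -
  note A = right_idealD[OF assms(2)]
  show ?thesis
  proof (rule right_idealI)
    show "x <# A \<subseteq> carrier R" using A(1) assms(1) by (auto simp: mem_l_coset_iff subset_iff)
    show "\<zero> \<in> x <# A" using A(2) assms(1) by (force simp: mem_l_coset_iff)
  next
    fix y z assume "y \<in> x <# A" "z \<in> x <# A"
    then obtain a b where "a \<in> A" "b \<in> A" "y = x \<otimes> a" "z = x \<otimes> b"
      by (auto simp: mem_l_coset_iff)
    then show "y \<oplus> z \<in> x <# A"
      using A(1,3) assms(1) by (auto simp: mem_l_coset_iff r_distr subset_iff intro!: bexI[of _ "a \<oplus> b"])
  next
    fix y r assume "y \<in> x <# A" "r \<in> carrier R"
    then obtain a where "a \<in> A" "y = x \<otimes> a" by (auto simp: mem_l_coset_iff)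
    then show "y \<otimes> r \<in> x <# A"
      using A(1,6) assms(1) \<open>r \<in> carrier R\<close>
      by (auto simp: mem_l_coset_iff m_assoc subset_iff intro!: bexI[of _ "a \<otimes> r"])
  qed
qed

lemma right_ideal_set_add:
  assumes "right_ideal A R" "right_ideal B R"
  shows "right_ideal (A <+> B) R"
proof -
  note A = right_idealD[OF assms(1)] and B = right_idealD[OF assms(2)]
  show ?thesis
  proof (rule right_idealI)
    show "A <+> B \<subseteq> carrier R" using A(1) B(1) by (auto simp: set_add_def')
    show "\<zero> \<in> A <+> B" using A(2) B(2) by (force simp: set_add_def')
  next
    fix y z assume "y \<in> A <+> B" "z \<in> A <+> B"
    then obtain a b a' b' where *: "a \<in> A" "b \<in> B" "y = a \<oplus> b" "a' \<in> A" "b' \<in> B" "z = a' \<oplus> b'"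
      by (auto simp: set_add_def')
    then have "y \<oplus> z = (a \<oplus> a') \<oplus> (b \<oplus> b')"
      using A(1) B(1) by (simp add: subset_iff a_ac)
    moreover have "a \<oplus> a' \<in> A" "b \<oplus> b' \<in> B" using * A(3) B(3) by blast+
    ultimately show "y \<oplus> z \<in> A <+> B" unfolding set_add_def' by blast
  next
    fix y r assume "y \<in> A <+> B" "r \<in> carrier R"
    then obtain a b where *: "a \<in> A" "b \<in> B" "y = a \<oplus> b"
      by (auto simp: set_add_def')
    then have "y \<otimes> r = (a \<otimes> r) \<oplus> (b \<otimes> r)"
      using A(1) B(1) \<open>r \<in> carrier R\<close> by (simp add: subset_iff l_distr)
    moreover have "a \<otimes> r \<in> A" "b \<otimes> r \<in> B" using * A(6) B(6) \<open>r \<in> carrier R\<close> by blast+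
    ultimately show "y \<otimes> r \<in> A <+> B" unfolding set_add_def' by blast
  qed
qed

lemma subset_set_add:
  assumes "right_ideal A R" "right_ideal B R"
  shows "A \<subseteq> A <+> B" "B \<subseteq> A <+> B"
  using right_idealD(1,2)[OF assms(1)] right_idealD(1,2)[OF assms(2)]
  by (force simp: set_add_def' subset_iff)+

lemma ideal_prod_mono:
  assumes "I \<subseteq> I'" "J \<subseteq> J'" shows "I \<cdot> J \<subseteq> I' \<cdot> J'"
proof
  fix x assume "x \<in> I \<cdot> J" then show "x \<in> I' \<cdot> J'"
    by induct (use assms in \<open>auto intro: ideal_prod.intros\<close>)
qed

lemma ideal_prod_subset:
  assumes "right_ideal T R" "\<And>a b. \<lbrakk>a \<in> A; b \<in> B\<rbrakk> \<Longrightarrow> a \<otimes> b \<in> T"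
  shows "A \<cdot> B \<subseteq> T"
proof
  fix x assume "x \<in> A \<cdot> B" then show "x \<in> T"
    by induct (use assms(2) right_idealD(3)[OF assms(1)] in auto)
qed

end

section \<open>Powers of an ideal\<close>

primrec ideal_pow :: "('a, 'm) ring_scheme \<Rightarrow> 'a set \<Rightarrow> nat \<Rightarrow> 'a set" where
  "ideal_pow R I 0 = carrier R"
| "ideal_pow R I (Suc n) = ideal_prod R (ideal_pow R I n) I"

context ideal
begin

abbreviation ipow :: "nat \<Rightarrow> 'a set" where "ipow \<equiv> ideal_pow R I"

lemma pow_ideal: "ideal (ipow n) R"
  by (induct n) (simp_all add: oneideal ideal_prod_is_ideal is_ideal)

lemma pow_right_ideal: "right_ideal (ipow n) R"
  by (rule right_ideal_of_ideal[OF pow_ideal])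

lemma pow_carr: "x \<in> ipow n \<Longrightarrow> x \<in> carrier R"
  using pow_ideal ideal.Icarr by fast

lemma pow_add: "ipow (m + n) = ipow m \<cdot> ipow n"
  by (induct n) (simp_all add: ideal_prod_one pow_ideal ideal_prod_assoc is_ideal)

lemma pow_mult_mem: "\<lbrakk>x \<in> ipow m; y \<in> ipow n\<rbrakk> \<Longrightarrow> x \<otimes> y \<in> ipow (m + n)"
  unfolding pow_add by (rule ideal_prod.prod)

lemma pow_antimono: "m \<le> n \<Longrightarrow> ipow n \<subseteq> ipow m"
proof (induct n rule: dec_induct)
  case (step n)
  then show ?case using ideal_prod_inter[OF pow_ideal is_ideal, of n] by auto
qed simp

lemma pow_one: "ipow 1 = I"
proof -
  have "carrier R \<cdot> I = I"
  proof
    show "carrier R \<cdot> I \<subseteq> I"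
      by (rule ideal_prod_subset[OF right_ideal_of_ideal[OF is_ideal]]) (rule I_l_closed)
    show "I \<subseteq> carrier R \<cdot> I"
      using ideal_prod.prod[of \<one> "carrier R" _ I R] by (auto simp: Icarr)
  qed
  then show ?thesis by simp
qed

lemma nat_pow_mem: "x \<in> I \<Longrightarrow> x [^] n \<in> ipow n"
  by (induct n) (auto intro: ideal_prod.prod)

end

text \<open>
  The form in which invertibility of \<open>I\<close> is used: for \<open>u\<close> in the power \<open>n + 1\<close> and \<open>1 = \<Sum> q\<^sub>i c\<^sub>i\<close>
  with \<open>q\<^sub>i \<in> I\<^bsup>-1\<^esup>\<close> and \<open>c\<^sub>i \<in> I\<close>, one has \<open>u = \<Sum> (u q\<^sub>i) c\<^sub>i\<close>.
\<close>
locale dividing_ideal = ideal +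
  assumes divide: "u \<in> ipow (Suc n) \<Longrightarrow> u \<in> {r \<in> ipow n. \<forall>c\<in>I. r \<otimes> c \<in> u <# carrier R} \<cdot> I"
begin

text \<open>For an invertible ideal and a right ideal \<open>T\<close> this is the part of
  \<open>T I^-n\<close> inside \<open>R\<close>, described by multiplication in \<open>R\<close>
  alone.\<close>

definition quot :: "'a set \<Rightarrow> nat \<Rightarrow> 'a set" where
  "quot T n = {r \<in> carrier R. \<forall>c\<in>ipow n. r \<otimes> c \<in> T}"

lemma quot_right_ideal:
  assumes "right_ideal T R" shows "right_ideal (quot T n) R"
proof (rule right_idealI)
  note T = right_idealD[OF assms]
  show "quot T n \<subseteq> carrier R" "\<zero> \<in> quot T n"
    using T(2) pow_carr by (auto simp: quot_def)
  show "x \<oplus> y \<in> quot T n" if "x \<in> quot T n" "y \<in> quot T n" for x y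
    using that T(3) pow_carr by (auto simp: quot_def l_distr)
  show "x \<otimes> r \<in> quot T n" if "x \<in> quot T n" "r \<in> carrier R" for x r
    using that pow_carr ideal.I_l_closed[OF pow_ideal] by (auto simp: quot_def m_assoc)
qed

lemma quot_mono: "T \<subseteq> Y \<Longrightarrow> quot T n \<subseteq> quot Y n"
  by (auto simp: quot_def)

lemma quot_prod_subset: "right_ideal T R \<Longrightarrow> quot T n \<cdot> ipow n \<subseteq> T"
  by (rule ideal_prod_subset) (auto simp: quot_def)

text \<open>Iterates \<open>divide\<close>: if \<open>a I\<close> lies in \<open>uR\<close> and
  \<open>r I^n\<close> lies in \<open>aR\<close>, then \<open>r I^(n+1)\<close> lies in
  \<open>uR\<close>. So the first factors found for \<open>a\<close> at exponent \<open>n\<close>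
  serve for \<open>u\<close> at exponent \<open>n + 1\<close>.\<close>

lemma divide_pow:
  "u \<in> ipow n \<Longrightarrow> u \<in> quot (u <# carrier R) n \<cdot> ipow n"
proof (induct n arbitrary: u)
  case 0
  then have u: "u \<in> carrier R" by simp
  then have "u \<otimes> \<one> \<in> quot (u <# carrier R) 0 \<cdot> ipow 0"
    by (intro ideal_prod.prod) (auto simp: quot_def mem_l_coset_iff)
  then show ?case using u by simp
next
  case (Suc n)
  let ?U = "u <# carrier R"
  let ?A = "{r \<in> ipow n. \<forall>c\<in>I. r \<otimes> c \<in> ?U}"
  have u: "u \<in> carrier R" using Suc.prems pow_carr[of u "Suc n"] by simp
  have U: "right_ideal ?U R" by (rule right_ideal_l_coset[OF u right_ideal_carrier])
  have step: "z \<otimes> c \<in> quot ?U (Suc n) \<cdot> ipow (Suc n)"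
    if a: "a \<in> ?A" and c: "c \<in> I" and z: "z \<in> quot (a <# carrier R) n \<cdot> ipow n" for a c z
    using z
  proof induct
    case (prod r e)
    have ac: "a \<in> carrier R" using a pow_carr by auto
    have rc: "r \<in> carrier R" using prod(1) by (simp add: quot_def)
    have "r \<otimes> g \<in> ?U" if g: "g \<in> ipow n \<cdot> I" for g
      using g
    proof induct
      case (prod e' c')
      then obtain t where t: "t \<in> carrier R" "r \<otimes> e' = a \<otimes> t"
        using \<open>r \<in> quot (a <# carrier R) n\<close> by (auto simp: quot_def mem_l_coset_iff)
      have "r \<otimes> (e' \<otimes> c') = a \<otimes> (t \<otimes> c')"
        using t ac rc prod pow_carr Icarr by (simp add: m_assoc[symmetric])
      also have "\<dots> \<in> ?U" using a t(1) prod(2) I_l_closed by auto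
      finally show ?case .
    next
      case (sum s1 s2)
      then have "s1 \<in> carrier R" "s2 \<in> carrier R"
        using pow_carr[of _ "Suc n"] by auto
      then show ?case using sum right_idealD(3)[OF U] rc by (simp add: r_distr)
    qed
    then have "r \<in> quot ?U (Suc n)" using rc by (simp add: quot_def)
    moreover have "(r \<otimes> e) \<otimes> c = r \<otimes> (e \<otimes> c)"
      using rc prod(2) c pow_carr Icarr by (simp add: m_assoc)
    ultimately show ?case using prod(2) c by (auto intro!: ideal_prod.prod)
  next
    case (sum s1 s2)
    have "quot (a <# carrier R) n \<cdot> ipow n \<subseteq> carrier R"
      by (rule ideal_prod_subset[OF right_ideal_carrier]) (auto simp: quot_def pow_carr)
    then have "s1 \<in> carrier R" "s2 \<in> carrier R" using sum by blast+
    then have "(s1 \<oplus> s2) \<otimes> c = s1 \<otimes> c \<oplus> s2 \<otimes> c" using c Icarr l_distr by blast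
    then show ?case using sum by (auto intro!: ideal_prod.sum)
  qed
  have "?A \<cdot> I \<subseteq> quot ?U (Suc n) \<cdot> ipow (Suc n)"
  proof
    fix z assume "z \<in> ?A \<cdot> I"
    then show "z \<in> quot ?U (Suc n) \<cdot> ipow (Suc n)"
      by induct (use step Suc.hyps in \<open>auto intro!: ideal_prod.sum\<close>)
  qed
  then show ?case using divide[OF Suc.prems] by blast
qed

text \<open>Makes \<open>T\<close> recoverable from its residual, so that \<open>quot\<close> at
  exponent \<open>n\<close> is injective on right ideals inside \<open>I^n\<close>. This is what
  lets \<open>R/I\<close> measure the layer \<open>I^n/I^(n+1)\<close>.\<close>

lemma quot_prod:
  assumes T: "right_ideal T R" "T \<subseteq> ipow n"
  shows "quot T n \<cdot> ipow n = T"
proof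
  show "quot T n \<cdot> ipow n \<subseteq> T" by (rule quot_prod_subset[OF T(1)])
  show "T \<subseteq> quot T n \<cdot> ipow n"
  proof
    fix u assume u: "u \<in> T"
    then have "u <# carrier R \<subseteq> T"
      using right_idealD(6)[OF T(1)] by (auto simp: mem_l_coset_iff)
    then show "u \<in> quot T n \<cdot> ipow n"
      using divide_pow[of u n] u T(2) ideal_prod_mono[OF quot_mono subset_refl] by blast
  qed
qed

text \<open>The residuals of \<open>xR\<close> by \<open>I^n\<close> grow as the powers shrink,
  hence stabilise at some \<open>m\<close>. An element of the intersection is then a sum of terms
  \<open>r e f\<close> with \<open>r e\<close> in \<open>xR\<close> and \<open>f\<close> in
  \<open>I^(n-m)\<close>, so the whole factor \<open>I^(n-m)\<close> survives to the right of
  \<open>x\<close>.\<close>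

lemma Artin_Rees:
  assumes noeth: "right_noetherian R" and x: "x \<in> carrier R"
  shows "\<exists>m. \<forall>n\<ge>m. (x <# carrier R) \<inter> ipow n \<subseteq> x <# ipow (n - m)"
proof -
  let ?X = "x <# carrier R"
  have T: "right_ideal ?X R" by (rule right_ideal_l_coset[OF x right_ideal_carrier])
  have "quot ?X n \<subseteq> quot ?X (Suc n)" for n
    using pow_antimono[of n "Suc n"] by (auto simp: quot_def)
  then obtain m where m: "\<And>n. n \<ge> m \<Longrightarrow> quot ?X n = quot ?X m"
    using noeth[unfolded right_noetherian_def, THEN spec[of _ "quot ?X"]] quot_right_ideal[OF T]
    by auto
  have "u \<in> x <# ipow (n - m)" if n: "n \<ge> m" and u: "u \<in> ?X" "u \<in> ipow n" for n u
  proof -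
    let ?Z = "x <# ipow (n - m)"
    have Z: "right_ideal ?Z R" by (rule right_ideal_l_coset[OF x pow_right_ideal])
    have "r \<otimes> (e \<otimes> f) \<in> ?Z" if r: "r \<in> quot ?X m" and e: "e \<in> ipow m" and f: "f \<in> ipow (n - m)" for r e f
    proof -
      obtain t where t: "t \<in> carrier R" "r \<otimes> e = x \<otimes> t"
        using r e by (auto simp: quot_def mem_l_coset_iff)
      have "r \<otimes> (e \<otimes> f) = x \<otimes> (t \<otimes> f)"
        using t r e f x pow_carr by (simp add: quot_def m_assoc[symmetric])
      moreover have "t \<otimes> f \<in> ipow (n - m)"
        using ideal.I_l_closed[OF pow_ideal f t(1)] .
      ultimately show ?thesis by (auto simp: mem_l_coset_iff)
    qed
    note base = this
    have "r \<otimes> g \<in> ?Z" if r: "r \<in> quot ?X m" and g: "g \<in> ipow m \<cdot> ipow (n - m)" for r g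
      using g
    proof induct
      case (prod e f)
      then show ?case using base[OF r] by blast
    next
      case (sum s1 s2)
      then have "s1 \<in> carrier R" "s2 \<in> carrier R"
        using pow_carr[of _ "m + (n - m)"] by (auto simp: pow_add)
      then show ?case using sum right_idealD(3)[OF Z] r by (simp add: r_distr quot_def)
    qed
    note mult = this
    have pn: "ipow n = ipow m \<cdot> ipow (n - m)" using pow_add[of m "n - m"] n by simp
    have "quot ?X n \<cdot> ipow n \<subseteq> ?Z"
    proof (rule ideal_prod_subset[OF Z])
      fix a b assume "a \<in> quot ?X n" "b \<in> ipow n"
      then show "a \<otimes> b \<in> ?Z" using mult[of a b] by (simp only: pn m[OF n])
    qed
    moreover have "u <# carrier R \<subseteq> ?X"
    proof
      fix y assume "y \<in> u <# carrier R"
      then obtain r where "r \<in> carrier R" "y = u \<otimes> r" unfolding mem_l_coset_iff by blast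
      then show "y \<in> ?X" using right_idealD(6)[OF T u(1)] by blast
    qed
    then have "quot (u <# carrier R) n \<cdot> ipow n \<subseteq> quot ?X n \<cdot> ipow n"
      by (rule ideal_prod_mono[OF quot_mono subset_refl])
    ultimately show ?thesis using divide_pow[OF u(2)] by (meson subsetD)
  qed
  then show ?thesis by (intro exI[of _ m] allI impI subsetI) simp
qed

text \<open>A Krull intersection argument. By Artin-Rees every \<open>y\<close> in the intersection
  \<open>W\<close> satisfies \<open>y = y z\<close> for some \<open>z\<close> in \<open>I\<close>;
  the left ideals \<open>A z\<close> of elements fixed by \<open>z\<close> are enlarged until one
  \<open>z\<close> fixes all of \<open>W\<close>. Then \<open>1 - z\<close> annihilates
  \<open>W\<close> from the right, and primeness leaves \<open>W = 0\<close> or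
  \<open>z = 1\<close>, the latter excluded because \<open>I\<close> is proper.\<close>

lemma Inter_pow_eq_zero:
  assumes prime: "prime_ring R" and left: "left_noetherian R" and right: "right_noetherian R"
    and proper: "I \<noteq> carrier R"
  shows "(\<Inter>n. ipow n) = {\<zero>}"
proof -
  define W where "W = (\<Inter>n. ipow n)"
  have W: "ideal W R"
    unfolding W_def using i_Intersect[of "range ipow"] pow_ideal by auto
  note Wr = right_idealD[OF right_ideal_of_ideal[OF W]]
  have Wc: "y \<in> carrier R" if "y \<in> W" for y using that Wr(1) by blast
  have fix_pt: "\<exists>z\<in>I. y \<otimes> z = y" if y: "y \<in> W" for y
  proof -
    have yc: "y \<in> carrier R" using y Wr(1) by auto
    obtain m where m: "\<And>n. n \<ge> m \<Longrightarrow> (y <# carrier R) \<inter> ipow n \<subseteq> y <# ipow (n - m)"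
      using Artin_Rees[OF right yc] by blast
    have "y \<in> y <# carrier R" using yc by (auto simp: mem_l_coset_iff intro!: bexI[of _ \<one>])
    \<comment> \<open>Exponent \<open>m + 1\<close> leaves exactly one factor \<open>I\<close> to
      the right of \<open>y\<close>.\<close>
    moreover have "y \<in> ipow (Suc m)" using y by (simp add: W_def del: ideal_pow.simps)
    ultimately have "y \<in> y <# ipow (Suc m - m)" using m[of "Suc m"] le_SucI[OF le_refl] by blast
    moreover have "Suc m - m = 1" by simp
    ultimately have "y \<in> y <# ipow 1" by (simp only:)
    then show ?thesis unfolding pow_one mem_l_coset_iff by metis
  qed
  define A where "A z = {y \<in> W. y \<otimes> z = y}" for z
  have A: "left_ideal (A z) R" if "z \<in> I" for z
    using Icarr[OF that] Wc Wr(2,3) ideal.I_l_closed[OF W]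
    by (intro left_idealI) (auto simp: A_def l_distr m_assoc)
  \<comment> \<open>\<open>1 - v = (1 - z) (1 - z')\<close>, where \<open>z'\<close> fixes \<open>y (1 - z)\<close>\<close>
  have ext: "\<exists>v\<in>I. insert y (A z) \<subseteq> A v" if z: "z \<in> I" and y: "y \<in> W" for z y
  proof -
    have zc: "z \<in> carrier R" and yc: "y \<in> carrier R" using z Icarr y Wr(1) by auto
    have "y \<ominus> y \<otimes> z \<in> W" using Wr(5,6) y zc by blast
    then obtain z' where z': "z' \<in> I" "(y \<ominus> y \<otimes> z) \<otimes> z' = y \<ominus> y \<otimes> z" using fix_pt by blast
    have z'c: "z' \<in> carrier R" using z' Icarr by auto
    let ?v = "z \<oplus> (z' \<ominus> z \<otimes> z')"
    have v: "?v \<in> I"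
      using right_idealD(3,5,6)[OF right_ideal_of_ideal[OF is_ideal]] z z'(1) z'c by simp
    have eq: "w \<otimes> ?v = w \<otimes> z \<oplus> (w \<ominus> w \<otimes> z) \<otimes> z'" if "w \<in> carrier R" for w
      using that zc z'c by (simp add: a_minus_def r_distr l_distr r_minus l_minus m_assoc a_ac)
    have "y \<otimes> ?v = y" unfolding eq[OF yc] z'(2) using yc zc by (simp add: a_minus_def a_ac r_neg)
    moreover have "w \<otimes> ?v = w" if "w \<in> A z" for w
    proof -
      have "w \<in> carrier R" "w \<otimes> z = w" using that Wr(1) by (auto simp: A_def)
      then show ?thesis using eq[of w] z'c by (simp add: r_neg a_minus_def)
    qed
    moreover have "A z \<subseteq> W" by (auto simp: A_def)
    ultimately have "insert y (A z) \<subseteq> A ?v" using y unfolding A_def[of ?v] by blast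
    then show ?thesis using v by blast
  qed
  have "\<exists>z\<in>I. \<forall>v\<in>I. \<not> A z \<subset> A v"
  proof (rule ccontr)
    assume "\<not> ?thesis"
    then have "\<forall>z\<in>I. \<exists>v\<in>I. A z \<subset> A v" by simp
    then obtain g where g: "\<And>z. z \<in> I \<Longrightarrow> g z \<in> I \<and> A z \<subset> A (g z)" by metis
    define f where "f n = (g ^^ n) \<zero>" for n
    have f: "f n \<in> I" for n by (induct n) (auto simp: f_def g zero_closed)
    have "A (f n) \<subset> A (f (Suc n))" for n using g[OF f[of n]] by (simp add: f_def)
    note less = this
    have "\<exists>m. \<forall>n\<ge>m. A (f n) = A (f m)"
      using left[unfolded left_noetherian_def, THEN spec[of _ "\<lambda>n. A (f n)"]] A[OF f]
        psubset_imp_subset[OF less] by blast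
    then obtain m where "A (f (Suc m)) = A (f m)" using le_SucI[OF le_refl] by blast
    then show False using less[of m] by simp
  qed
  then obtain z where z: "z \<in> I" "\<And>v. v \<in> I \<Longrightarrow> \<not> A z \<subset> A v" by blast
  have fixed: "y \<otimes> z = y" if "y \<in> W" for y
    using ext[OF z(1) that] z(2) that by (auto simp: A_def)
  have zc: "z \<in> carrier R" using z Icarr by auto
  \<comment> \<open>The right annihilator of \<open>W\<close>; it is also a left ideal because
    \<open>W\<close> is closed under right multiplication.\<close>
  let ?K = "{r \<in> carrier R. \<forall>y\<in>W. y \<otimes> r = \<zero>}"
  have K: "ideal ?K R"
  proof -
    have "right_ideal ?K R"
      using Wc by (intro right_idealI) (auto simp: r_distr m_assoc[symmetric])
    moreover have "left_ideal ?K R"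
      using Wc Wr(6) by (intro left_idealI) (auto simp: r_distr m_assoc[symmetric])
    ultimately show ?thesis
      unfolding right_ideal_def left_ideal_def
      by (intro idealI ring_axioms) (auto simp: additive_subgroup_def)
  qed
  have "W \<cdot> ?K = {\<zero>}"
  proof -
    have "W \<cdot> ?K \<subseteq> {\<zero>}"
      by (rule ideal_prod_subset[OF right_ideal_of_ideal[OF zeroideal]]) auto
    moreover have "\<zero> \<in> W \<cdot> ?K"
      using ideal_prod_is_ideal[OF W K] additive_subgroup.zero_closed ideal.axioms(1) by blast
    ultimately show ?thesis by blast
  qed
  then have "W = {\<zero>} \<or> ?K = {\<zero>}"
    using prime W K unfolding prime_ring_def by blast
  moreover have "?K \<noteq> {\<zero>}"
  proof
    assume K0: "?K = {\<zero>}"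
    have "\<one> \<ominus> z \<in> ?K"
    proof -
      have "y \<otimes> (\<one> \<ominus> z) = \<zero>" if y: "y \<in> W" for y
      proof -
        have yc: "y \<in> carrier R" using y Wr(1) by auto
        have "y \<otimes> (\<one> \<ominus> z) = y \<ominus> y \<otimes> z" using yc zc by (simp add: a_minus_def r_distr r_minus)
        then show ?thesis using fixed[OF y] yc by (simp add: r_neg a_minus_def)
      qed
      then show ?thesis using zc by auto
    qed
    then have "\<one> \<ominus> z = \<zero>" using K0 by blast
    then have "\<one> = z" using zc by (metis one_closed r_right_minus_eq)
    then show False using z(1) one_imp_carrier proper by blast
  qed
  ultimately show ?thesis unfolding W_def by blast
qed

end


section \<open>Counting dimensions\<close>

lemma mem_set_add_l_coset_iff:
  "y \<in> A <+>\<^bsub>G\<^esub> (w <#\<^bsub>G\<^esub> B) \<longleftrightarrow> (\<exists>a\<in>A. \<exists>b\<in>B. y = a \<oplus>\<^bsub>G\<^esub> w \<otimes>\<^bsub>G\<^esub> b)"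
  "y \<in> (w <#\<^bsub>G\<^esub> B) <+>\<^bsub>G\<^esub> A \<longleftrightarrow> (\<exists>b\<in>B. \<exists>a\<in>A. y = w \<otimes>\<^bsub>G\<^esub> b \<oplus>\<^bsub>G\<^esub> a)"
  by (auto simp: set_add_def' l_coset_def)

text \<open>The scalars are realised inside \<open>R\<close>, so that scalar multiplication is ring
  multiplication; centrality makes every right ideal a \<open>K\<close>-subspace.\<close>

locale central_subfield = ring R + K?: subfield K R for K and R (structure) +
  assumes central: "\<lbrakk>c \<in> K; x \<in> carrier R\<rbrakk> \<Longrightarrow> c \<otimes> x = x \<otimes> c"
begin

definition subspace_of :: "'a set \<Rightarrow> bool" where
  "subspace_of V \<longleftrightarrow> V \<subseteq> carrier R \<and> \<zero> \<in> V \<and> (\<forall>x\<in>V. \<forall>y\<in>V. x \<oplus> y \<in> V) \<and>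
     (\<forall>c\<in>K. \<forall>x\<in>V. c \<otimes> x \<in> V)"

text \<open>For a subspace \<open>V\<close>, an inclusion of \<open>B\<close> in
  \<open>span_over V ws\<close> bounds the dimension of \<open>(B + V)/V\<close> by
  \<open>length ws\<close>; such lists serve as upper bounds for dimensions.\<close>

primrec span_over :: "'a set \<Rightarrow> 'a list \<Rightarrow> 'a set" where
  "span_over V [] = V"
| "span_over V (w # ws) = {a \<oplus> c \<otimes> w | a c. a \<in> span_over V ws \<and> c \<in> K}"

lemma K_carr: "c \<in> K \<Longrightarrow> c \<in> carrier R"
  using K.subset by blast

lemma K_zero: "\<zero> \<in> K" and K_minus_one: "\<ominus> \<one> \<in> K"
  and K_add: "\<lbrakk>c \<in> K; d \<in> K\<rbrakk> \<Longrightarrow> c \<oplus> d \<in> K"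
  and K_mult: "\<lbrakk>c \<in> K; d \<in> K\<rbrakk> \<Longrightarrow> c \<otimes> d \<in> K"
  using subringE(2,3,5,6,7)[OF K.subring_axioms] by auto

lemma subspaceD:
  assumes "subspace_of V"
  shows "x \<in> V \<Longrightarrow> x \<in> carrier R" "\<zero> \<in> V"
    and "\<lbrakk>x \<in> V; y \<in> V\<rbrakk> \<Longrightarrow> x \<oplus> y \<in> V"
    and "\<lbrakk>c \<in> K; x \<in> V\<rbrakk> \<Longrightarrow> c \<otimes> x \<in> V"
    and "\<lbrakk>x \<in> V; y \<in> V\<rbrakk> \<Longrightarrow> x \<ominus> y \<in> V"
proof -
  show c: "\<And>x. x \<in> V \<Longrightarrow> x \<in> carrier R" and "\<zero> \<in> V"
    and a: "\<And>x y. \<lbrakk>x \<in> V; y \<in> V\<rbrakk> \<Longrightarrow> x \<oplus> y \<in> V"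
    and m: "\<And>c x. \<lbrakk>c \<in> K; x \<in> V\<rbrakk> \<Longrightarrow> c \<otimes> x \<in> V"
    using assms by (auto simp: subspace_of_def)
  show "x \<ominus> y \<in> V" if "x \<in> V" "y \<in> V"
  proof -
    have "\<ominus> \<one> \<otimes> y = \<ominus> y" using c[OF that(2)] by (simp add: l_minus)
    then show ?thesis
      using a[OF that(1) m[OF K_minus_one that(2)]] by (simp add: a_minus_def)
  qed
qed

lemma subspace_right_ideal:
  assumes "right_ideal V R" shows "subspace_of V"
proof -
  note V = right_idealD[OF assms]
  have "c \<otimes> x \<in> V" if "c \<in> K" "x \<in> V" for c x
    using V(1) V(6)[OF that(2) K_carr[OF that(1)]] central[OF that(1), of x] that(2) by auto
  then show ?thesis using V(1,2,3) by (simp add: subspace_of_def)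
qed

lemma span_over_append: "span_over V (vs @ ws) = span_over (span_over V ws) vs"
  by (induct vs) auto

lemma span_over_mono: "V \<subseteq> V' \<Longrightarrow> span_over V ws \<subseteq> span_over V' ws"
  by (induct ws) auto

lemma span_over_least:
  assumes "V \<subseteq> H" "\<And>x y. \<lbrakk>x \<in> H; y \<in> H\<rbrakk> \<Longrightarrow> x \<oplus> y \<in> H"
    and "\<And>c w. \<lbrakk>c \<in> K; w \<in> set ws\<rbrakk> \<Longrightarrow> c \<otimes> w \<in> H"
  shows "span_over V ws \<subseteq> H"
  using assms(3)
proof (induct ws)
  case Nil
  then show ?case using assms(1) by simp
next
  case (Cons w ws)
  then have "span_over V ws \<subseteq> H" by simp
  then show ?case using Cons.prems assms(2) by auto
qed

lemma span_over_subspace: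
  assumes "subspace_of V" "set ws \<subseteq> carrier R"
  shows "subspace_of (span_over V ws)"
  using assms(2)
proof (induct ws)
  case Nil
  then show ?case using assms(1) by simp
next
  case (Cons w ws)
  then have w: "w \<in> carrier R" and S: "subspace_of (span_over V ws)" by auto
  note S = subspaceD[OF S]
  show ?case
    unfolding subspace_of_def
  proof (intro conjI ballI subsetI)
    fix x assume "x \<in> span_over V (w # ws)"
    then show "x \<in> carrier R" using S(1) w K_carr by auto
  next
    have "\<zero> = \<zero> \<oplus> \<zero> \<otimes> w" using w by simp
    then show "\<zero> \<in> span_over V (w # ws)" using S(2) K_zero by auto
  next
    fix x y assume "x \<in> span_over V (w # ws)" "y \<in> span_over V (w # ws)"
    then obtain a b c d where *: "a \<in> span_over V ws" "b \<in> span_over V ws" "c \<in> K" "d \<in> K"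
      "x = a \<oplus> c \<otimes> w" "y = b \<oplus> d \<otimes> w" by auto
    then have "x \<oplus> y = (a \<oplus> b) \<oplus> (c \<oplus> d) \<otimes> w"
      using w S(1) K_carr by (simp add: l_distr a_ac)
    moreover have "a \<oplus> b \<in> span_over V ws" "c \<oplus> d \<in> K" using * S(3) K_add by auto
    ultimately show "x \<oplus> y \<in> span_over V (w # ws)" by auto
  next
    fix e x assume e: "e \<in> K" and "x \<in> span_over V (w # ws)"
    then obtain a c where *: "a \<in> span_over V ws" "c \<in> K" "x = a \<oplus> c \<otimes> w" by auto
    then have "e \<otimes> x = e \<otimes> a \<oplus> (e \<otimes> c) \<otimes> w"
      using w S(1) K_carr e by (simp add: r_distr m_assoc)
    moreover have "e \<otimes> a \<in> span_over V ws" "e \<otimes> c \<in> K" using * e S(4) K_mult by auto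
    ultimately show "e \<otimes> x \<in> span_over V (w # ws)" by auto
  qed
qed

lemma span_over_Cons_superset:
  assumes "subspace_of V" "set (w # ws) \<subseteq> carrier R"
  shows "span_over V ws \<subseteq> span_over V (w # ws)"
proof
  fix x assume x: "x \<in> span_over V ws"
  then have "x = x \<oplus> \<zero> \<otimes> w"
    using subspaceD(1)[OF span_over_subspace[OF assms(1), of ws]] assms(2) by simp
  then show "x \<in> span_over V (w # ws)" using x K_zero by auto
qed

lemma span_over_superset:
  assumes "subspace_of V" "set ws \<subseteq> carrier R"
  shows "V \<subseteq> span_over V ws"
  using assms(2)
proof (induct ws)
  case (Cons w ws)
  then show ?case using span_over_Cons_superset[OF assms(1) Cons.prems] by auto
qed simp

text \<open>
  A substitute for the dimension of \<open>Z / V\<close>: the number of jumps of the filtration of \<open>Z\<close> induced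
  by \<open>V \<subseteq> span_over V [w\<^sub>n] \<subseteq> span_over V [w\<^sub>n\<^sub>-\<^sub>1, w\<^sub>n] \<subseteq> \<dots>\<close>.
\<close>
primrec jumps :: "'a set \<Rightarrow> 'a set \<Rightarrow> 'a list \<Rightarrow> nat" where
  "jumps V Z [] = 0"
| "jumps V Z (w # ws) =
     jumps V Z ws + (if Z \<inter> span_over V (w # ws) \<subseteq> span_over V ws then 0 else 1)"

lemma jumps_le_length: "jumps V Z ws \<le> length ws"
  by (induct ws) auto

lemma jumps_mono: "Z \<subseteq> Z' \<Longrightarrow> jumps V Z ws \<le> jumps V Z' ws"
proof (induct ws)
  case (Cons w ws)
  then have "Z \<inter> span_over V (w # ws) \<subseteq> span_over V ws"
    if "Z' \<inter> span_over V (w # ws) \<subseteq> span_over V ws" using that by blast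
  then show ?case using Cons by (simp del: span_over.simps)
qed simp

text \<open>Each jump of \<open>Z\<close> is a jump of \<open>Z'\<close>, so equal counts mean jumps
  at the same places. At a common jump, an element of \<open>Z\<close> with nonzero
  \<open>w\<close>-coefficient removes that coefficient from any element of \<open>Z'\<close>, and
  the difference lies one step lower in the filtration.\<close>

lemma jumps_eq_imp_subset:
  assumes V: "subspace_of V" and ws: "set ws \<subseteq> carrier R"
    and Z: "subspace_of Z" "subspace_of Z'" "V \<subseteq> Z" "Z \<subseteq> Z'"
    and eq: "jumps V Z ws = jumps V Z' ws"
  shows "Z' \<inter> span_over V ws \<subseteq> Z"
  using ws eq
proof (induct ws)
  case Nil
  then show ?case using Z(3) by auto
next
  case (Cons w ws)
  have w: "w \<in> carrier R" and ws: "set ws \<subseteq> carrier R" using Cons.prems by auto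
  note S = subspaceD[OF span_over_subspace[OF V ws]]
  let ?T = "span_over V (w # ws)" and ?S = "span_over V ws"
  have le: "jumps V Z ws \<le> jumps V Z' ws" by (rule jumps_mono[OF Z(4)])
  have imp: "Z \<inter> ?T \<subseteq> ?S" if "Z' \<inter> ?T \<subseteq> ?S" using that Z(4) by blast
  have jw: "jumps V Z ws = jumps V Z' ws" and jt: "Z \<inter> ?T \<subseteq> ?S \<Longrightarrow> Z' \<inter> ?T \<subseteq> ?S"
    using Cons.prems(2) le imp by (auto simp del: span_over.simps split: if_splits)
  have IH: "Z' \<inter> ?S \<subseteq> Z" using Cons.hyps[OF ws jw] .
  show ?case
  proof
    fix y assume y: "y \<in> Z' \<inter> ?T"
    show "y \<in> Z"
    proof (cases "Z \<inter> ?T \<subseteq> ?S")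
      case True
      then show ?thesis using jt y IH by blast
    next
      case False
      then obtain x where x: "x \<in> Z" "x \<in> ?T" "x \<notin> ?S" by blast
      obtain a c where a: "a \<in> ?S" "c \<in> K" "x = a \<oplus> c \<otimes> w" using x(2) by auto
      obtain b d where b: "b \<in> ?S" "d \<in> K" "y = b \<oplus> d \<otimes> w" using y by auto
      have "c \<noteq> \<zero>" using x(3) a S(1) w by auto
      then have inv: "inv c \<in> K" "inv c \<otimes> c = \<one>"
        using subfield_m_inv[OF K.subfield_axioms, of c] a(2) by auto
      \<comment> \<open>The ratio of the \<open>w\<close>-coefficients of \<open>y\<close> and
        \<open>x\<close>, so that \<open>y - e x\<close> lies in the span without
        \<open>w\<close>.\<close>
      let ?e = "d \<otimes> inv c"
      have e: "?e \<in> K" using b(2) inv(1) by simp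
      have ec: "?e \<otimes> c = d"
        using inv a(2) b(2) K_carr by (simp add: m_assoc)
      have "?e \<otimes> x = ?e \<otimes> a \<oplus> d \<otimes> w"
        using a S(1) w K_carr e by (simp add: r_distr m_assoc[symmetric] ec del: K.m_closed)
      moreover have "b \<oplus> d \<otimes> w \<ominus> (?e \<otimes> a \<oplus> d \<otimes> w) = b \<ominus> ?e \<otimes> a"
      proof -
        have "b \<in> carrier R" "d \<otimes> w \<in> carrier R" "?e \<otimes> a \<in> carrier R"
          using a b S(1) w K_carr e by simp_all
        then show ?thesis by (simp add: a_minus_def minus_add a_ac r_neg2 r_neg)
      qed
      ultimately have "y \<ominus> ?e \<otimes> x = b \<ominus> ?e \<otimes> a" using b(3) by simp
      also have "\<dots> \<in> ?S" using S(4,5) e a(1) b(1) by blast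
      finally have "y \<ominus> ?e \<otimes> x \<in> ?S" .
      moreover have exZ: "?e \<otimes> x \<in> Z" using subspaceD(4)[OF Z(1) e x(1)] .
      moreover have "y \<ominus> ?e \<otimes> x \<in> Z'" using subspaceD(5)[OF Z(2)] y exZ Z(4) by blast
      ultimately have "y \<ominus> ?e \<otimes> x \<in> Z" using IH by blast
      then have "(y \<ominus> ?e \<otimes> x) \<oplus> ?e \<otimes> x \<in> Z" using exZ subspaceD(3)[OF Z(1)] by blast
      moreover have "(y \<ominus> ?e \<otimes> x) \<oplus> ?e \<otimes> x = y"
        using subspaceD(1)[OF Z(1) exZ] subspaceD(1)[OF Z(2)] y
        by (simp add: a_minus_def a_assoc l_neg)
      ultimately show ?thesis by simp
    qed
  qed
qed

lemma jumps_strict_mono: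
  assumes "subspace_of V" "set ws \<subseteq> carrier R" "carrier R \<subseteq> span_over V ws"
    and "subspace_of Z" "subspace_of Z'" "V \<subseteq> Z" "Z \<subset> Z'"
  shows "jumps V Z ws < jumps V Z' ws"
proof -
  have "jumps V Z ws \<noteq> jumps V Z' ws"
    using jumps_eq_imp_subset[OF assms(1,2,4,5,6)] assms(3,7) subspaceD(1)[OF assms(5)] by blast
  then show ?thesis using jumps_mono[OF psubset_imp_subset[OF assms(7)], of V ws] by simp
qed

end

section \<open>Dimension bounds for the quotients \<open>R / I^n\<close>\<close>

locale finite_codim_ideal = central_subfield K R + dividing_ideal I R
  for K and I and R (structure) +
  fixes basis :: "'a list"
  assumes basis_carrier: "set basis \<subseteq> carrier R"
    and basis_span: "carrier R \<subseteq> span_over I basis"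
begin

text \<open>Left multiplication by \<open>w\<close> is \<open>K\<close>-linear because
  \<open>K\<close> is central. Since it carries \<open>I\<close> into \<open>A\<close>, it turns a
  spanning list of \<open>R/I\<close> into one of \<open>(A + wR)/A\<close> of the same
  length.\<close>

lemma mult_span_over:
  assumes "w \<in> carrier R" "\<And>z. z \<in> I \<Longrightarrow> w \<otimes> z \<in> A" "set bs \<subseteq> carrier R"
  shows "r \<in> span_over I bs \<Longrightarrow> w \<otimes> r \<in> span_over A (map ((\<otimes>) w) bs)"
  using assms(3)
proof (induct bs arbitrary: r)
  case Nil
  then show ?case using assms(2) by simp
next
  case (Cons b bs)
  then obtain a c where *: "a \<in> span_over I bs" "c \<in> K" "r = a \<oplus> c \<otimes> b" by auto
  have I: "subspace_of I" by (rule subspace_right_ideal[OF right_ideal_of_ideal[OF is_ideal]])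
  have a: "a \<in> carrier R" using subspaceD(1)[OF span_over_subspace[OF I] *(1)] Cons.prems by simp
  have "w \<otimes> (c \<otimes> b) = c \<otimes> (w \<otimes> b)"
    using assms(1) Cons.prems(2) K_carr[OF *(2)] central[OF *(2) assms(1)]
    by (simp add: m_assoc[symmetric])
  then have "w \<otimes> r = w \<otimes> a \<oplus> c \<otimes> (w \<otimes> b)"
    using * a assms(1) Cons.prems(2) K_carr[OF *(2)] by (simp add: r_distr)
  then show ?case using Cons.hyps[OF *(1)] Cons.prems(2) *(2) by auto
qed

text \<open>Climbing from \<open>A\<close> to \<open>B\<close> through right ideals
  \<open>A + wR\<close> with \<open>wI\<close> inside \<open>A\<close>, each step costs
  \<open>length basis\<close> generators by \<open>mult_span_over\<close>, and strict monotonicity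
  of \<open>rank\<close> limits the number of steps. Leaving \<open>rank\<close> free allows sizes
  to be measured in a different quotient, at the price of the factor
  \<open>length basis\<close>.\<close>

lemma span_interval:
  fixes rank :: "'a set \<Rightarrow> nat"
  assumes A: "right_ideal A R" and B: "right_ideal B R" and "A \<subseteq> B"
    and nilp: "\<And>a z. \<lbrakk>a \<in> B; z \<in> ipow p\<rbrakk> \<Longrightarrow> a \<otimes> z \<in> A"
    and rank: "\<And>Z Z'. \<lbrakk>right_ideal Z R; right_ideal Z' R; A \<subseteq> Z; Z \<subset> Z'; Z' \<subseteq> B\<rbrakk>
                  \<Longrightarrow> rank Z < rank Z'"
  shows "\<exists>ws. set ws \<subseteq> carrier R \<and> B \<subseteq> span_over A ws
           \<and> length ws \<le> (rank B - rank A) * length basis"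
  using A \<open>A \<subseteq> B\<close> nilp rank
proof (induct "rank B - rank A" arbitrary: A rule: less_induct)
  case less
  show ?case
  proof (cases "A = B")
    case True
    then show ?thesis by (intro exI[of _ "[]"]) simp
  next
    case False
    note Ad = right_idealD[OF less.prems(1)] and Bd = right_idealD[OF B]
    define P where "P q \<longleftrightarrow> (\<forall>a\<in>B. \<forall>z\<in>ipow q. a \<otimes> z \<in> A)" for q
    have "P p" using less.prems(3) by (simp add: P_def)
    moreover have "\<not> P 0"
    proof
      assume P0: "P 0"
      have "a \<in> A" if "a \<in> B" for a
      proof -
        have "a \<otimes> \<one> \<in> A" using P0 that by (simp add: P_def)
        then show ?thesis using that Bd(1) by (simp add: subset_iff)
      qed
      then show False using False less.prems(2) by blast
    qed
    \<comment> \<open>At such an exponent some product of \<open>B\<close> and \<open>I^q\<close>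
      escapes \<open>A\<close>, yet one more factor from \<open>I\<close> brings it back; this
      product is the next \<open>w\<close>.\<close>
    ultimately have "\<exists>q. \<not> P q \<and> P (Suc q)" by (induct p) blast+
    then obtain q where q: "\<not> P q" "P (Suc q)" by blast
    then obtain a z where az: "a \<in> B" "z \<in> ipow q" "a \<otimes> z \<notin> A" by (auto simp: P_def)
    define w where "w = a \<otimes> z"
    have ac: "a \<in> carrier R" "z \<in> carrier R" using az Bd(1) pow_carr by auto
    have w: "w \<in> carrier R" "w \<in> B" "w \<notin> A"
      using ac az Bd(6) by (auto simp: w_def)
    have wI: "w \<otimes> i \<in> A" if "i \<in> I" for i
    proof -
      have "w \<otimes> i = a \<otimes> (z \<otimes> i)" using ac Icarr[OF that] by (simp add: w_def m_assoc)
      moreover have "z \<otimes> i \<in> ipow (Suc q)" using az(2) that by (auto intro: ideal_prod.prod)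
      ultimately show ?thesis using q(2) az(1) by (simp add: P_def del: ideal_pow.simps)
    qed
    define A' where "A' = A <+> (w <# carrier R)"
    have wR: "right_ideal (w <# carrier R) R"
      by (rule right_ideal_l_coset[OF w(1) right_ideal_carrier])
    have A': "right_ideal A' R" unfolding A'_def by (rule right_ideal_set_add[OF less.prems(1) wR])
    have sub: "A \<subseteq> A'" "w <# carrier R \<subseteq> A'"
      unfolding A'_def using subset_set_add[OF less.prems(1) wR] by auto
    have "w \<otimes> \<one> \<in> w <# carrier R" unfolding mem_l_coset_iff using one_closed by blast
    then have "w \<in> A'" using sub w(1) by auto
    then have AA': "A \<subset> A'" using sub w(3) by blast
    have A'B: "A' \<subseteq> B"
    proof
      fix y assume "y \<in> A'"
      then obtain a r where "a \<in> A" "r \<in> carrier R" "y = a \<oplus> w \<otimes> r"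
        unfolding A'_def mem_set_add_l_coset_iff by blast
      then show "y \<in> B" using less.prems(2) Bd(3)[of a "w \<otimes> r"] Bd(6)[OF w(2)] by auto
    qed
    have r1: "rank A < rank A'" using less.prems(4)[OF less.prems(1) A' _ AA' A'B] by simp
    have r2: "rank A' \<le> rank B"
      using less.prems(4)[OF A' B sub(1) _ subset_refl] A'B by (metis less_imp_le order_refl psubsetI)
    have "\<exists>ws. set ws \<subseteq> carrier R \<and> B \<subseteq> span_over A' ws
           \<and> length ws \<le> (rank B - rank A') * length basis"
    proof (rule less.hyps[OF _ A' A'B])
      show "rank B - rank A' < rank B - rank A" using r1 r2 by simp
      show "a \<otimes> z \<in> A'" if "a \<in> B" "z \<in> ipow p" for a z using less.prems(3)[OF that] sub(1) by blast
      show "rank Z < rank Z'"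
        if "right_ideal Z R" "right_ideal Z' R" "A' \<subseteq> Z" "Z \<subset> Z'" "Z' \<subseteq> B" for Z Z'
        using less.prems(4)[OF that(1,2) _ that(4,5)] that(3) sub(1) by blast
    qed
    then obtain ws where ws: "set ws \<subseteq> carrier R" "B \<subseteq> span_over A' ws"
      "length ws \<le> (rank B - rank A') * length basis" by blast
    let ?ms = "map ((\<otimes>) w) basis"
    have ms: "set ?ms \<subseteq> carrier R" using basis_carrier w(1) by auto
    have As: "subspace_of A" by (rule subspace_right_ideal[OF less.prems(1)])
    note S = subspaceD[OF span_over_subspace[OF As ms]]
    have "A' \<subseteq> span_over A ?ms"
    proof
      fix y assume "y \<in> A'"
      then obtain a r where *: "a \<in> A" "r \<in> carrier R" "y = a \<oplus> w \<otimes> r"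
        unfolding A'_def mem_set_add_l_coset_iff by blast
      have "w \<otimes> r \<in> span_over A ?ms"
        using mult_span_over[OF w(1) wI basis_carrier] basis_span *(2) by blast
      then show "y \<in> span_over A ?ms"
        using * S(3) span_over_superset[OF As ms] by blast
    qed
    then have "B \<subseteq> span_over A (ws @ ?ms)"
      using ws(2) span_over_mono[of A' "span_over A ?ms" ws] by (auto simp: span_over_append)
    moreover have "length (ws @ ?ms) \<le> (rank B - rank A) * length basis"
    proof -
      have "length (ws @ ?ms) \<le> (rank B - rank A' + 1) * length basis" using ws(3) by simp
      also have "\<dots> \<le> (rank B - rank A) * length basis"
        using r1 r2 by (intro mult_right_mono) auto
      finally show ?thesis .
    qed
    ultimately show ?thesis using ws(1) ms by (intro exI[of _ "ws @ ?ms"]) auto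
  qed
qed

text \<open>Taking residuals by \<open>I^n\<close> embeds the right ideals between
  \<open>I^(n+1)\<close> and \<open>I^n\<close> strictly monotonically into those between
  \<open>I\<close> and \<open>R\<close>, so a chain has at most \<open>length basis\<close> steps.
  Each step adds at most \<open>length basis\<close> generators, whence the square.\<close>

lemma span_layer:
  "\<exists>ws. set ws \<subseteq> carrier R \<and> ipow n \<subseteq> span_over (ipow (Suc n)) ws
     \<and> length ws \<le> length basis * length basis"
proof -
  let ?rank = "\<lambda>Z. jumps I (quot Z n) basis"
  have "\<exists>ws. set ws \<subseteq> carrier R \<and> ipow n \<subseteq> span_over (ipow (Suc n)) ws
     \<and> length ws \<le> (?rank (ipow n) - ?rank (ipow (Suc n))) * length basis"
  proof (rule span_interval[where rank = ?rank and p = 1, OF pow_right_ideal pow_right_ideal])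
    show "ipow (Suc n) \<subseteq> ipow n" by (rule pow_antimono) simp
    show "a \<otimes> z \<in> ipow (Suc n)" if "a \<in> ipow n" "z \<in> ipow 1" for a z
      using pow_mult_mem[OF that] by (simp del: ideal_pow.simps)
  next
    fix Z Z' assume Z: "right_ideal Z R" "right_ideal Z' R" "ipow (Suc n) \<subseteq> Z" "Z \<subset> Z'"
      "Z' \<subseteq> ipow n"
    have "r \<in> quot Z n" if r: "r \<in> I" for r
    proof -
      have "r \<otimes> c \<in> ipow (Suc n)" if "c \<in> ipow n" for c
        using pow_mult_mem[of r 1 c n] r that unfolding pow_one by simp
      then show ?thesis using Z(3) Icarr[OF r] by (auto simp: quot_def simp del: ideal_pow.simps)
    qed
    moreover have "quot Z n \<subset> quot Z' n"
    proof -
      have "Z \<subseteq> ipow n" using Z(4,5) by blast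
      then have "quot Z n \<noteq> quot Z' n"
        using quot_prod[OF Z(1)] quot_prod[OF Z(2,5)] Z(4) by (metis psubsetE subset_refl)
      then show ?thesis using quot_mono[of Z Z' n] Z(4) by blast
    qed
    ultimately show "?rank Z < ?rank Z'"
      by (intro jumps_strict_mono[OF subspace_right_ideal[OF right_ideal_of_ideal[OF is_ideal]]
            basis_carrier basis_span subspace_right_ideal[OF quot_right_ideal[OF Z(1)]]
            subspace_right_ideal[OF quot_right_ideal[OF Z(2)]]] subsetI)
  qed
  then obtain ws where ws: "set ws \<subseteq> carrier R" "ipow n \<subseteq> span_over (ipow (Suc n)) ws"
    "length ws \<le> (?rank (ipow n) - ?rank (ipow (Suc n))) * length basis" by blast
  have "?rank (ipow n) - ?rank (ipow (Suc n)) \<le> length basis"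
    using jumps_le_length diff_le_self order_trans by blast
  then have "length ws \<le> length basis * length basis"
    using ws(3) by (meson mult_le_mono1 order_trans)
  then show ?thesis using ws(1,2) by blast
qed

lemma span_pow:
  "\<exists>ws. set ws \<subseteq> carrier R \<and> carrier R \<subseteq> span_over (ipow n) ws
     \<and> length ws \<le> n * (length basis * length basis)"
proof (induct n)
  case 0
  show ?case by (intro exI[of _ "[]"]) simp
next
  case (Suc n)
  obtain vs where vs: "set vs \<subseteq> carrier R" "carrier R \<subseteq> span_over (ipow n) vs"
    "length vs \<le> n * (length basis * length basis)" using Suc by blast
  obtain ws where ws: "set ws \<subseteq> carrier R" "ipow n \<subseteq> span_over (ipow (Suc n)) ws"
    "length ws \<le> length basis * length basis" using span_layer by blast
  have "carrier R \<subseteq> span_over (ipow (Suc n)) (vs @ ws)"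
    unfolding span_over_append using vs(2) span_over_mono[OF ws(2), of vs] by (rule order_trans)
  moreover have "length (vs @ ws) \<le> Suc n * (length basis * length basis)"
    using vs(3) ws(3) by simp
  ultimately show ?case using vs(1) ws(1) by (intro exI[of _ "vs @ ws"]) (simp del: ideal_pow.simps)
qed

text \<open>Each cancelled factor \<open>x\<close> loses \<open>m\<close> in the exponent.
  Subtraction is truncated, so for \<open>n \<le> j * m\<close> the conclusion only places
  \<open>y\<close> in \<open>R\<close>.\<close>

lemma pow_cancel:
  assumes x: "x \<in> carrier R"
    and m: "\<And>n y. \<lbrakk>y \<in> carrier R; x \<otimes> y \<in> ipow n\<rbrakk> \<Longrightarrow> y \<in> ipow (n - m)"
  shows "\<lbrakk>y \<in> carrier R; x [^] j \<otimes> y \<in> ipow n\<rbrakk> \<Longrightarrow> y \<in> ipow (n - j * m)"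
proof (induct j arbitrary: n y)
  case (Suc j)
  have "x [^] j \<otimes> (x \<otimes> y) \<in> ipow n" using Suc.prems x by (simp add: m_assoc)
  then have "x \<otimes> y \<in> ipow (n - j * m)" using Suc.hyps Suc.prems(1) x by simp
  then show ?case using m[OF Suc.prems(1), of "n - j * m"] by (simp add: add.commute)
qed simp

text \<open>
  If \<open>x\<close> is cancellable, then multiplication by \<open>x\<close> on \<open>R / I\<^bsup>n\<^esup>\<close> has a kernel of bounded
  dimension, hence so has its cokernel, although the dimension of \<open>R / I\<^bsup>n\<^esup>\<close> grows with \<open>n\<close>.
\<close>
lemma span_mod_cancellable:
  assumes noeth: "right_noetherian R" and x: "x \<in> carrier R"
    and cancel: "\<And>y. \<lbrakk>y \<in> carrier R; x \<otimes> y = \<zero>\<rbrakk> \<Longrightarrow> y = \<zero>"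
  shows "\<exists>b. \<forall>n. \<exists>ws. set ws \<subseteq> carrier R \<and> length ws \<le> b \<and>
           carrier R \<subseteq> span_over ((x <# carrier R) <+> ipow n) ws"
proof -
  obtain m where AR: "\<And>n. n \<ge> m \<Longrightarrow> (x <# carrier R) \<inter> ipow n \<subseteq> x <# ipow (n - m)"
    using Artin_Rees[OF noeth x] by blast
  \<comment> \<open>Artin-Rees after cancelling \<open>x\<close>: the kernel of \<open>x\<close> on
    \<open>R/I^n\<close> lies in \<open>I^(n-m)/I^n\<close>. For \<open>n < m\<close> truncated
    subtraction makes the claim trivial.\<close>
  have m: "y \<in> ipow (n - m)" if y: "y \<in> carrier R" "x \<otimes> y \<in> ipow n" for n y
  proof (cases "n \<ge> m")
    case True
    have "x \<otimes> y \<in> x <# carrier R" unfolding mem_l_coset_iff using y(1) by blast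
    then have "x \<otimes> y \<in> x <# ipow (n - m)" using AR[OF True] y(2) by blast
    then obtain z where z: "z \<in> ipow (n - m)" "x \<otimes> y = x \<otimes> z" unfolding mem_l_coset_iff by blast
    have zc: "z \<in> carrier R" using z(1) pow_carr by blast
    have "x \<otimes> (y \<ominus> z) = \<zero>"
      using z(2) zc y x by (simp add: a_minus_def r_distr r_minus r_neg)
    then have "y \<ominus> z = \<zero>" using cancel zc y(1) by simp
    then show ?thesis using z(1) zc y(1) by simp
  next
    case False
    then show ?thesis using y(1) by simp
  qed
  define D where "D = length basis * length basis"
  have "\<exists>ws. set ws \<subseteq> carrier R \<and> length ws \<le> m * D * length basis \<and>
           carrier R \<subseteq> span_over ((x <# carrier R) <+> ipow n0) ws" for n0
  proof -
    \<comment> \<open>\<open>J\<close> drops of at least \<open>m D + 1\<close> would give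
      \<open>J (m D + 1) \<le> n D = n0 D + J m D\<close>, that is \<open>J \<le> n0 D\<close>,
      which this choice of \<open>J\<close> excludes. Moreover \<open>n - j m \<ge> n0\<close> for
      \<open>j < J\<close>, so cancelling \<open>x^j\<close> modulo \<open>I^n\<close> still ends
      inside \<open>I^n0\<close>.\<close>
    define J where "J = n0 * D + 1"
    define n where "n = n0 + J * m"
    obtain vs where vs: "set vs \<subseteq> carrier R" "carrier R \<subseteq> span_over (ipow n) vs"
      "length vs \<le> n * D" using span_pow[of n] unfolding D_def by blast
    define E where "E j Z = (x [^] j <# Z) <+> ipow n" for j :: nat and Z
    define f where "f Z = jumps (ipow n) Z vs" for Z
    define A where "A = (x <# carrier R) <+> ipow n0"
    have xj: "x [^] j \<in> carrier R" for j :: nat using x by simp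
    have xR: "right_ideal (x <# carrier R) R" by (rule right_ideal_l_coset[OF x right_ideal_carrier])
    have A: "right_ideal A R" unfolding A_def by (rule right_ideal_set_add[OF xR pow_right_ideal])
    have xA: "x <# carrier R \<subseteq> A" "ipow n0 \<subseteq> A"
      unfolding A_def using subset_set_add[OF xR pow_right_ideal] by auto
    have E: "right_ideal (E j Z) R" "ipow n \<subseteq> E j Z" if "right_ideal Z R" for j Z
      unfolding E_def using right_ideal_set_add subset_set_add(2) right_ideal_l_coset[OF xj that]
        pow_right_ideal by blast+
    have E_mono: "E j Z \<subseteq> E j Z'" if "Z \<subseteq> Z'" for j Z Z'
      using that unfolding E_def subset_iff mem_set_add_l_coset_iff by blast
    have E_Suc: "E (Suc j) (carrier R) \<subseteq> E j A" for j
    proof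
      fix y assume "y \<in> E (Suc j) (carrier R)"
      then obtain r w where *: "r \<in> carrier R" "w \<in> ipow n" "y = x [^] Suc j \<otimes> r \<oplus> w"
        unfolding E_def mem_set_add_l_coset_iff by blast
      have "x \<otimes> r \<in> A" using xA(1) *(1) unfolding subset_iff mem_l_coset_iff by blast
      moreover have "x [^] Suc j \<otimes> r = x [^] j \<otimes> (x \<otimes> r)" using x *(1) by (simp add: m_assoc)
      ultimately show "y \<in> E j A"
        unfolding E_def mem_set_add_l_coset_iff using *(2,3) by auto
    qed
    \<comment> \<open>Pigeonhole on the chain \<open>x^j R + I^n\<close>: its rank starts at no more
      than \<open>n D\<close>, so one of the first \<open>J\<close> steps drops by at most
      \<open>m D\<close>.\<close>
    have "\<exists>j<J. f (E j (carrier R)) \<le> f (E (Suc j) (carrier R)) + m * D"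
    proof (rule ccontr)
      assume "\<not> ?thesis"
      then have *: "f (E (Suc j) (carrier R)) + m * D + 1 \<le> f (E j (carrier R))" if "j < J" for j
        using that by (auto simp: not_le)
      have "f (E j (carrier R)) + j * (m * D + 1) \<le> f (E 0 (carrier R))" if "j \<le> J" for j
        using that
      proof (induct j)
        case (Suc j)
        then show ?case using *[of j] by (simp add: algebra_simps)
      qed simp
      from this[of J] have "J * (m * D + 1) \<le> f (E 0 (carrier R))" by simp
      also have "\<dots> \<le> n * D" unfolding f_def using jumps_le_length vs(3) order_trans by blast
      also have "\<dots> = n0 * D + J * (m * D)" by (simp add: n_def algebra_simps)
      finally show False by (simp add: J_def)
    qed
    then obtain j where j: "j < J" "f (E j (carrier R)) \<le> f (E (Suc j) (carrier R)) + m * D" by blast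
    \<comment> \<open>Right ideals above \<open>A\<close> are ranked through their images
      \<open>x^j Z + I^n\<close>, strictly because \<open>x^j\<close> can be cancelled. As
      \<open>E (Suc j) (carrier R)\<close> lies in \<open>E j A\<close>, the ranks of
      \<open>R\<close> and \<open>A\<close> differ by no more than the small drop just
      found.\<close>
    have "\<exists>ws. set ws \<subseteq> carrier R \<and> carrier R \<subseteq> span_over A ws \<and>
      length ws \<le> (f (E j (carrier R)) - f (E j A)) * length basis"
    proof (rule span_interval[where rank = "\<lambda>Z. f (E j Z)" and p = n0, OF A right_ideal_carrier right_idealD(1)[OF A]])
      show "a \<otimes> z \<in> A" if "a \<in> carrier R" "z \<in> ipow n0" for a z
        using ideal.I_l_closed[OF pow_ideal that(2,1)] xA(2) by blast
    next
      fix Z Z' assume Z: "right_ideal Z R" "right_ideal Z' R" "A \<subseteq> Z" "Z \<subset> Z'"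
      note Zd = right_idealD[OF Z(1)] and Zd' = right_idealD[OF Z(2)]
      have "E j Z \<noteq> E j Z'"
      proof
        assume eq: "E j Z = E j Z'"
        have "u \<in> Z" if u: "u \<in> Z'" for u
        proof -
          have uc: "u \<in> carrier R" using u Zd'(1) by blast
          have "x [^] j \<otimes> u \<in> x [^] j <# Z'" unfolding mem_l_coset_iff using u by blast
          then have "x [^] j \<otimes> u \<in> E j Z'"
            unfolding E_def
            using subset_set_add(1)[OF right_ideal_l_coset[OF xj Z(2)] pow_right_ideal] by blast
          then have "x [^] j \<otimes> u \<in> E j Z" by (simp only: eq)
          then obtain v w where v: "v \<in> Z" "w \<in> ipow n" "x [^] j \<otimes> u = x [^] j \<otimes> v \<oplus> w"
            unfolding E_def mem_set_add_l_coset_iff by blast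
          have vc: "v \<in> carrier R" "w \<in> carrier R" using v Zd(1) pow_carr by auto
          have "x [^] j \<otimes> (u \<ominus> v) = w"
          proof -
            have "x [^] j \<otimes> (u \<ominus> v) = (x [^] j \<otimes> v \<oplus> w) \<ominus> x [^] j \<otimes> v"
              using v(3) uc vc xj by (simp add: a_minus_def r_distr r_minus)
            also have "\<dots> = w" using vc xj[of j] by (simp add: a_minus_def a_ac r_neg)
            finally show ?thesis .
          qed
          then have "u \<ominus> v \<in> ipow (n - j * m)"
            using pow_cancel[OF x m] v(2) uc vc(1) by blast
          moreover have "n0 \<le> n - j * m"
          proof -
            have "j * m \<le> J * m" using j(1) by (intro mult_right_mono) auto
            then show ?thesis unfolding n_def by linarith
          qed
          ultimately have "u \<ominus> v \<in> Z" using pow_antimono xA(2) Z(3) by blast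
          then have "(u \<ominus> v) \<oplus> v \<in> Z" using Zd(3) v(1) by blast
          then show ?thesis using uc vc(1) by (simp add: a_minus_def a_assoc l_neg)
        qed
        then show False using Z(4) by blast
      qed
      then have "E j Z \<subset> E j Z'" using E_mono[of Z Z' j] Z(4) by blast
      then show "f (E j Z) < f (E j Z')"
        unfolding f_def
        by (intro jumps_strict_mono subspace_right_ideal pow_right_ideal vs(1,2) E Z(1,2))
    qed
    then obtain ws where ws: "set ws \<subseteq> carrier R" "carrier R \<subseteq> span_over A ws"
      "length ws \<le> (f (E j (carrier R)) - f (E j A)) * length basis" by blast
    have "f (E (Suc j) (carrier R)) \<le> f (E j A)"
      unfolding f_def by (rule jumps_mono[OF E_Suc])
    then have "f (E j (carrier R)) - f (E j A) \<le> m * D" using j(2) by simp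
    then have "length ws \<le> m * D * length basis" using ws(3) by (meson mult_le_mono1 order_trans)
    then show ?thesis using ws(1,2) unfolding A_def by blast
  qed
  then show ?thesis by blast
qed

end


section \<open>The standard identity\<close>

definition standard_poly :: "nat \<Rightarrow> nc_poly" where
  "standard_poly p =
     (\<Sum>\<pi> | \<pi> permutes {..<p}. Poly_Mapping.single (map \<pi> [0..<p]) (sign \<pi>))"

text \<open>Ensures that no two terms of \<open>standard_poly\<close> merge, so that each
  coefficient is a sign.\<close>

lemma inj_on_map_permutes: "inj_on (\<lambda>\<pi>. map \<pi> [0..<p]) {\<pi>. \<pi> permutes {..<p}}"
proof (rule inj_onI)
  fix \<pi> \<rho> :: "nat \<Rightarrow> nat"
  assume *: "\<pi> \<in> {\<pi>. \<pi> permutes {..<p}}" "\<rho> \<in> {\<pi>. \<pi> permutes {..<p}}"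
    and eq: "map \<pi> [0..<p] = map \<rho> [0..<p]"
  show "\<pi> = \<rho>"
  proof
    fix i
    show "\<pi> i = \<rho> i"
    proof (cases "i < p")
      case True
      then show ?thesis using eq by (auto simp: map_eq_conv)
    next
      case False
      then show ?thesis using * by (simp add: permutes_def)
    qed
  qed
qed

lemma lookup_standard_poly:
  assumes "\<pi> permutes {..<p}"
  shows "Poly_Mapping.lookup (standard_poly p) (map \<pi> [0..<p]) = sign \<pi>"
proof -
  have "Poly_Mapping.lookup (standard_poly p) (map \<pi> [0..<p]) =
      (\<Sum>\<rho> | \<rho> permutes {..<p}. if \<rho> = \<pi> then sign \<rho> else 0)"
    unfolding standard_poly_def lookup_sum lookup_single
    using assms inj_on_map_permutes[of p]
    by (intro sum.cong) (auto simp: when_def inj_on_def)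
  then show ?thesis using assms by (simp add: sum.delta' finite_permutations)
qed

lemma keys_standard_poly:
  "Poly_Mapping.keys (standard_poly p) = (\<lambda>\<pi>. map \<pi> [0..<p]) ` {\<pi>. \<pi> permutes {..<p}}"
proof
  show "(\<lambda>\<pi>. map \<pi> [0..<p]) ` {\<pi>. \<pi> permutes {..<p}} \<subseteq> Poly_Mapping.keys (standard_poly p)"
    by (auto simp: in_keys_iff lookup_standard_poly)
  show "Poly_Mapping.keys (standard_poly p) \<subseteq> (\<lambda>\<pi>. map \<pi> [0..<p]) ` {\<pi>. \<pi> permutes {..<p}}"
  proof
    fix w assume "w \<in> Poly_Mapping.keys (standard_poly p)"
    then have "(\<Sum>\<rho> | \<rho> permutes {..<p}. sign \<rho> when map \<rho> [0..<p] = w) \<noteq> 0"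
      by (simp add: in_keys_iff standard_poly_def lookup_sum lookup_single)
    then obtain \<rho> where "\<rho> permutes {..<p}" "(sign \<rho> when map \<rho> [0..<p] = w) \<noteq> 0"
      by (metis (mono_tags, lifting) mem_Collect_eq sum.neutral)
    then show "w \<in> (\<lambda>\<pi>. map \<pi> [0..<p]) ` {\<pi>. \<pi> permutes {..<p}}"
      by (auto simp: when_def split: if_splits)
  qed
qed

lemma nc_monom_eval_Nil: "nc_monom_eval R x [] = \<one>\<^bsub>R\<^esub>"
  and nc_monom_eval_Cons: "nc_monom_eval R x (i # w) = x i \<otimes>\<^bsub>R\<^esub> nc_monom_eval R x w"
  by (simp_all add: nc_monom_eval_def)

context ring
begin

text \<open>The sign as a ring element: integer coefficients become central factors, to which
  distributivity of \<open>finsum\<close> applies.\<close>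

definition sgn_of :: "(nat \<Rightarrow> nat) \<Rightarrow> 'a" where
  "sgn_of \<pi> = (if evenperm \<pi> then \<one> else \<ominus> \<one>)"

lemma sgn_of_closed [simp]: "sgn_of \<pi> \<in> carrier R"
  by (simp add: sgn_of_def)

lemma sgn_of_central: "y \<in> carrier R \<Longrightarrow> sgn_of \<pi> \<otimes> y = y \<otimes> sgn_of \<pi>"
  by (simp add: sgn_of_def l_minus r_minus)

lemma nc_monom_eval_closed:
  "(\<And>i. x i \<in> carrier R) \<Longrightarrow> nc_monom_eval R x w \<in> carrier R"
  by (induct w) (simp_all add: nc_monom_eval_Nil nc_monom_eval_Cons)

lemma nc_poly_eval_standard_poly:
  assumes x: "\<And>i. x i \<in> carrier R"
  shows "nc_poly_eval R x (standard_poly p) =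
    (\<Oplus>\<pi>\<in>{\<pi>. \<pi> permutes {..<p}}. sgn_of \<pi> \<otimes> nc_monom_eval R x (map \<pi> [0..<p]))"
proof -
  let ?P = "{\<pi>. \<pi> permutes {..<p}}"
  have "nc_poly_eval R x (standard_poly p) =
    (\<Oplus>\<pi>\<in>?P. [Poly_Mapping.lookup (standard_poly p) (map \<pi> [0..<p])] \<cdot> nc_monom_eval R x (map \<pi> [0..<p]))"
    unfolding nc_poly_eval_def keys_standard_poly
    by (rule finsum_reindex[OF _ inj_on_map_permutes]) (auto intro: nc_monom_eval_closed x)
  also have "\<dots> = (\<Oplus>\<pi>\<in>?P. sgn_of \<pi> \<otimes> nc_monom_eval R x (map \<pi> [0..<p]))"
  proof (rule finsum_cong'[OF refl])
    fix \<pi> assume "\<pi> \<in> ?P"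
    moreover have "[(- 1 :: int)] \<cdot> y = \<ominus> y" if "y \<in> carrier R" for y
      using add.int_pow_neg[OF that, of 1] that by (simp add: a_inv_def)
    ultimately show "[Poly_Mapping.lookup (standard_poly p) (map \<pi> [0..<p])] \<cdot> nc_monom_eval R x (map \<pi> [0..<p])
        = sgn_of \<pi> \<otimes> nc_monom_eval R x (map \<pi> [0..<p])"
      using nc_monom_eval_closed[of x, OF x]
      by (simp add: lookup_standard_poly sign_def sgn_of_def l_minus)
  qed (use nc_monom_eval_closed[of x, OF x] in auto)
  finally show ?thesis .
qed

lemma finsum_swap:
  assumes "finite A" "finite B" "\<And>a b. \<lbrakk>a \<in> A; b \<in> B\<rbrakk> \<Longrightarrow> f a b \<in> carrier R"
  shows "(\<Oplus>a\<in>A. \<Oplus>b\<in>B. f a b) = (\<Oplus>b\<in>B. \<Oplus>a\<in>A. f a b)"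
  using assms(1,3)
proof (induct A rule: finite_induct)
  case empty
  then show ?case by simp
next
  case (insert a A)
  have "(\<Oplus>b\<in>B. \<Oplus>a\<in>insert a A. f a b) = (\<Oplus>b\<in>B. f a b \<oplus> (\<Oplus>a\<in>A. f a b))"
    using insert by (intro finsum_cong' refl) (auto simp: Pi_iff)
  also have "\<dots> = (\<Oplus>b\<in>B. f a b) \<oplus> (\<Oplus>b\<in>B. \<Oplus>a\<in>A. f a b)"
    using insert by (intro finsum_addf) (auto simp: Pi_iff)
  also have "\<dots> = (\<Oplus>b\<in>B. f a b) \<oplus> (\<Oplus>a\<in>A. \<Oplus>b\<in>B. f a b)"
    using insert by simp
  also have "\<dots> = (\<Oplus>a\<in>insert a A. \<Oplus>b\<in>B. f a b)"
    using insert by (subst finsum_insert) (auto simp: Pi_iff)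
  finally show ?case ..
qed

text \<open>Composition with the transposition pairs each even permutation with an odd one on which
  \<open>F\<close> agrees, and the two signed terms cancel. Cancelling in pairs, rather than showing
  that the sum equals its negative, is valid in characteristic 2 as well.\<close>

lemma alternating_sum_eq_zero:
  assumes t: "t1 < p" "t2 < p" "t1 \<noteq> t2"
    and F: "\<And>\<pi>. \<pi> permutes {..<p} \<Longrightarrow> F \<pi> \<in> carrier R"
    and inv: "\<And>\<pi>. \<pi> permutes {..<p} \<Longrightarrow> F (\<pi> \<circ> Transposition.transpose t1 t2) = F \<pi>"
  shows "(\<Oplus>\<pi>\<in>{\<pi>. \<pi> permutes {..<p}}. sgn_of \<pi> \<otimes> F \<pi>) = \<zero>"
proof -
  let ?P = "{\<pi>. \<pi> permutes {..<p}}" and ?\<tau> = "Transposition.transpose t1 t2"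
  define E where "E = {\<pi> \<in> ?P. evenperm \<pi>}"
  define O' where "O' = {\<pi> \<in> ?P. \<not> evenperm \<pi>}"
  have fin: "finite E" "finite O'"
    unfolding E_def O'_def using finite_permutations[of "{..<p}"] by auto
  have tau: "?\<tau> permutes {..<p}" using t by (intro permutes_swap_id) auto
  have perm: "permutation \<pi>" if "\<pi> permutes {..<p}" for \<pi>
    by (rule permutation_permutes[THEN iffD2]) (use that in blast)
  have ev: "evenperm (\<pi> \<circ> ?\<tau>) \<longleftrightarrow> \<not> evenperm \<pi>" if "\<pi> permutes {..<p}" for \<pi>
    using evenperm_comp[OF perm[OF that] perm[OF tau]] t(3) by (simp add: evenperm_swap)
  have comp: "\<pi> \<circ> ?\<tau> permutes {..<p}" if "\<pi> permutes {..<p}" for \<pi>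
    using permutes_compose[OF tau that] .
  have O'E: "O' = (\<lambda>\<pi>. \<pi> \<circ> ?\<tau>) ` E"
  proof
    show "(\<lambda>\<pi>. \<pi> \<circ> ?\<tau>) ` E \<subseteq> O'" using ev comp by (auto simp: E_def O'_def)
    show "O' \<subseteq> (\<lambda>\<pi>. \<pi> \<circ> ?\<tau>) ` E"
    proof
      fix \<pi> assume "\<pi> \<in> O'"
      then have "\<pi> \<circ> ?\<tau> \<in> E" using ev comp by (auto simp: E_def O'_def)
      moreover have "\<pi> = (\<pi> \<circ> ?\<tau>) \<circ> ?\<tau>" by (simp add: comp_assoc)
      ultimately show "\<pi> \<in> (\<lambda>\<pi>. \<pi> \<circ> ?\<tau>) ` E" by blast
    qed
  qed
  have inj: "inj_on (\<lambda>\<pi>. \<pi> \<circ> ?\<tau>) E"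
    by (rule inj_on_inverseI[of _ "\<lambda>\<pi>. \<pi> \<circ> ?\<tau>"]) (simp add: comp_assoc)
  have Fc: "F \<in> E \<rightarrow> carrier R" using F by (auto simp: E_def)
  have "(\<Oplus>\<pi>\<in>O'. sgn_of \<pi> \<otimes> F \<pi>) = (\<Oplus>\<pi>\<in>E. sgn_of (\<pi> \<circ> ?\<tau>) \<otimes> F (\<pi> \<circ> ?\<tau>))"
    unfolding O'E by (rule finsum_reindex[OF _ inj]) (use F comp in \<open>auto simp: E_def\<close>)
  also have "\<dots> = (\<Oplus>\<pi>\<in>E. \<ominus> F \<pi>)"
    using F by (intro finsum_cong' refl) (auto simp: E_def sgn_of_def ev inv l_minus)
  finally have odd: "(\<Oplus>\<pi>\<in>O'. sgn_of \<pi> \<otimes> F \<pi>) = (\<Oplus>\<pi>\<in>E. \<ominus> F \<pi>)" .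
  have even: "(\<Oplus>\<pi>\<in>E. sgn_of \<pi> \<otimes> F \<pi>) = (\<Oplus>\<pi>\<in>E. F \<pi>)"
    using F by (intro finsum_cong' refl) (auto simp: E_def sgn_of_def)
  have PE: "?P = E \<union> O'" by (auto simp: E_def O'_def)
  have "E \<inter> O' = {}" by (auto simp: E_def O'_def)
  moreover have "(\<lambda>\<pi>. sgn_of \<pi> \<otimes> F \<pi>) \<in> E \<rightarrow> carrier R" "(\<lambda>\<pi>. sgn_of \<pi> \<otimes> F \<pi>) \<in> O' \<rightarrow> carrier R"
    using F by (simp_all add: E_def O'_def)
  ultimately have "(\<Oplus>\<pi>\<in>?P. sgn_of \<pi> \<otimes> F \<pi>) = (\<Oplus>\<pi>\<in>E. sgn_of \<pi> \<otimes> F \<pi>) \<oplus> (\<Oplus>\<pi>\<in>O'. sgn_of \<pi> \<otimes> F \<pi>)"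
    unfolding PE by (rule finsum_Un_disjoint[OF fin])
  also have "\<dots> = (\<Oplus>\<pi>\<in>E. F \<pi> \<oplus> \<ominus> F \<pi>)"
    unfolding odd even using Fc by (subst finsum_addf) (auto simp: Pi_iff)
  also have "\<dots> = (\<Oplus>\<pi>\<in>E. \<zero>)"
    using Fc by (intro finsum_cong' refl) (auto simp: Pi_iff r_neg)
  finally show ?thesis by simp
qed

text \<open>
  The elements of \<open>R\<close> act from the right on the left \<open>C\<close>-module \<open>R\<close>, generated by the \<open>b j\<close>, through
  \<open>r \<times> r\<close> matrices \<open>M v\<close> over \<open>C\<close>.  Pushing one generator after the other through the words of the
  standard polynomial leaves, for every path of \<open>p\<close> matrix positions, an alternating sum.  As
  \<open>p > r\<^sup>2\<close>, some position occurs twice on the path and the sum vanishes.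
\<close>
lemma standard_identity:
  fixes b :: "nat \<Rightarrow> 'a"
  assumes C: "subcring C R" and b: "\<And>j. j < r \<Longrightarrow> b j \<in> carrier R"
    and gen: "\<And>y. y \<in> carrier R \<Longrightarrow> \<exists>\<gamma>\<in>{..<r} \<rightarrow> C. y = (\<Oplus>j\<in>{..<r}. \<gamma> j \<otimes> b j)"
    and p: "r * r < p" and x: "\<And>i. x i \<in> carrier R"
  shows "nc_poly_eval R x (standard_poly p) = \<zero>"
proof -
  let ?P = "{\<pi>. \<pi> permutes {..<p}}"
  let ?w = "\<lambda>\<pi> l. nc_monom_eval R x (map \<pi> [l..<p])"
  let ?C = "R\<lparr>carrier := C\<rparr>"
  have CR: "c \<in> carrier R" if "c \<in> C" for c using subcringE(1)[OF C] that by blast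
  interpret C: cring ?C using subcring_iff[OF subcringE(1)[OF C]] C by blast
  have finP: "finite ?P" by (rule finite_permutations) simp
  have w: "?w \<pi> l \<in> carrier R" for \<pi> l by (rule nc_monom_eval_closed[OF x])
  have "\<exists>\<gamma>\<in>{..<r} \<rightarrow> C. b i \<otimes> x v = (\<Oplus>j\<in>{..<r}. \<gamma> j \<otimes> b j)" if "i < r" for v i
    using gen b[OF that] x by simp
  then have "\<forall>v i. \<exists>\<gamma>. i < r \<longrightarrow> \<gamma> \<in> {..<r} \<rightarrow> C \<and> b i \<otimes> x v = (\<Oplus>j\<in>{..<r}. \<gamma> j \<otimes> b j)"
    by blast
  then obtain M where M: "\<And>v i. i < r \<Longrightarrow> M v i \<in> {..<r} \<rightarrow> C"
    and bx: "\<And>v i. i < r \<Longrightarrow> b i \<otimes> x v = (\<Oplus>j\<in>{..<r}. M v i j \<otimes> b j)"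
    by metis
  have MC: "M v i j \<in> C" if "i < r" "j < r" for v i j using M[OF that(1)] that(2) by auto
  \<comment> \<open>The weight of the path \<open>i 0, ..., i l\<close> when step \<open>t\<close>
    uses the matrix of the letter \<open>\<pi> t\<close>. The product is formed over
    \<open>C\<close>, where commutativity makes the order of its factors immaterial.\<close>
  define G where "G l i \<pi> = finprod ?C (\<lambda>t. M (\<pi> t) (i t) (i (Suc t))) {..<l}" for l i and \<pi> :: "nat \<Rightarrow> nat"
  have GC: "G l i \<pi> \<in> C" if "\<forall>t\<le>l. i t < r" for l i \<pi>
  proof -
    have "finprod ?C (\<lambda>t. M (\<pi> t) (i t) (i (Suc t))) {..<l} \<in> carrier ?C"
      using that by (intro C.finprod_closed) (auto intro!: MC)
    then show ?thesis by (simp add: G_def)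
  qed
  have G_Suc: "G (Suc l) (i(Suc l := h)) \<pi> = G l i \<pi> \<otimes> M (\<pi> l) (i l) h"
    if i: "\<forall>t\<le>l. i t < r" and h: "h < r" for l i h \<pi>
  proof -
    let ?i = "i(Suc l := h)"
    have "G (Suc l) ?i \<pi> = M (\<pi> l) (?i l) (?i (Suc l)) \<otimes>\<^bsub>?C\<^esub>
        finprod ?C (\<lambda>t. M (\<pi> t) (?i t) (?i (Suc t))) {..<l}"
      unfolding G_def lessThan_Suc using i h by (intro C.finprod_insert) (auto intro!: MC)
    also have "finprod ?C (\<lambda>t. M (\<pi> t) (?i t) (?i (Suc t))) {..<l} = G l i \<pi>"
      unfolding G_def using i by (intro C.finprod_cong' refl) (auto intro!: MC)
    also have "M (\<pi> l) (?i l) (?i (Suc l)) \<otimes>\<^bsub>?C\<^esub> G l i \<pi> = G l i \<pi> \<otimes>\<^bsub>?C\<^esub> M (\<pi> l) (i l) h"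
      using C.m_comm[of "G l i \<pi>" "M (\<pi> l) (i l) h"] GC[OF i, of \<pi>] MC[of "i l" h "\<pi> l"] i h by simp
    finally show ?thesis by (simp add: fun_upd_def)
  qed
  \<comment> \<open>The alternating sum along a fixed path after \<open>l\<close> letters have been
    absorbed: \<open>T 0\<close> still carries whole words, \<open>T p\<close> carries none.
    Vanishing is proved downwards from \<open>l = p\<close>.\<close>
  define T where "T l i = (\<Oplus>\<pi>\<in>?P. sgn_of \<pi> \<otimes> (G l i \<pi> \<otimes> b (i l) \<otimes> ?w \<pi> l))" for l i
  have T: "T l i = \<zero>" if "l \<le> p" "\<forall>t\<le>l. i t < r" for l i
    using that
  proof (induct l arbitrary: i rule: inc_induct)
    case base
    note i = base
    \<comment> \<open>A path with \<open>p\<close> steps and only \<open>r * r\<close> available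
      positions repeats one; exchanging the letters used at the two places leaves its weight
      unchanged.\<close>
    have "\<not> inj_on (\<lambda>t. (i t, i (Suc t))) {..<p}"
    proof
      assume "inj_on (\<lambda>t. (i t, i (Suc t))) {..<p}"
      then have "card {..<p} \<le> card ({..<r} \<times> {..<r})"
        using i by (intro card_inj_on_le) auto
      then show False using p by simp
    qed
    then obtain t1 t2 where t: "t1 < p" "t2 < p" "t1 \<noteq> t2" "i t1 = i t2" "i (Suc t1) = i (Suc t2)"
      by (auto simp: inj_on_def)
    let ?\<tau> = "Transposition.transpose t1 t2"
    have tau: "?\<tau> permutes {..<p}" using t by (intro permutes_swap_id) auto
    have it: "i (?\<tau> s) = i s" "i (Suc (?\<tau> s)) = i (Suc s)" for s
      using t(4,5) by (simp_all add: Transposition.transpose_def)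
    have inv: "G p i (\<pi> \<circ> ?\<tau>) = G p i \<pi>" for \<pi>
    proof -
      have "G p i \<pi> = finprod ?C (\<lambda>t. M (\<pi> t) (i t) (i (Suc t))) (?\<tau> ` {..<p})"
        by (simp add: G_def permutes_image[OF tau])
      also have "\<dots> = finprod ?C (\<lambda>t. M (\<pi> (?\<tau> t)) (i (?\<tau> t)) (i (Suc (?\<tau> t)))) {..<p}"
      proof (rule C.finprod_reindex)
        show "(\<lambda>t. M (\<pi> t) (i t) (i (Suc t))) \<in> ?\<tau> ` {..<p} \<rightarrow> carrier ?C"
          using i unfolding permutes_image[OF tau] by (auto intro!: MC)
        show "inj_on ?\<tau> {..<p}" using permutes_inj_on[OF tau] .
      qed
      also have "\<dots> = G p i (\<pi> \<circ> ?\<tau>)" by (simp add: G_def it)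
      finally show ?thesis ..
    qed
    show ?case unfolding T_def
    proof (rule alternating_sum_eq_zero[OF t(1,2,3)])
      show "G p i \<pi> \<otimes> b (i p) \<otimes> ?w \<pi> p \<in> carrier R" for \<pi>
        using i GC[OF i] CR b by (intro m_closed w) auto
      show "G p i (\<pi> \<circ> ?\<tau>) \<otimes> b (i p) \<otimes> ?w (\<pi> \<circ> ?\<tau>) p = G p i \<pi> \<otimes> b (i p) \<otimes> ?w \<pi> p" for \<pi>
        by (simp add: inv)
    qed
  next
    case (step l)
    note i = step.prems
    have il: "i l < r" using i by simp
    let ?f = "\<lambda>\<pi> h. sgn_of \<pi> \<otimes> (G (Suc l) (i(Suc l := h)) \<pi> \<otimes> b h \<otimes> ?w \<pi> (Suc l))"
    have upd: "\<forall>t\<le>Suc l. (i(Suc l := h)) t < r" if "h < r" for h using i that by (auto simp: le_Suc_eq)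
    have f: "?f \<pi> h \<in> carrier R" if "h < r" for \<pi> h
      by (intro m_closed w sgn_of_closed CR b[OF that] GC[OF upd[OF that]])
    have "T l i = (\<Oplus>\<pi>\<in>?P. \<Oplus>h\<in>{..<r}. ?f \<pi> h)"
      unfolding T_def
    proof (rule finsum_cong'[OF refl])
      show "(\<lambda>\<pi>. \<Oplus>h\<in>{..<r}. ?f \<pi> h) \<in> ?P \<rightarrow> carrier R" using f by (auto simp: Pi_iff)
    next
      fix \<pi> assume "\<pi> \<in> ?P"
      have Gc: "G l i \<pi> \<in> carrier R" using GC[OF i] CR by blast
      have "?w \<pi> l = x (\<pi> l) \<otimes> ?w \<pi> (Suc l)"
        using step.hyps(2) by (simp add: upt_conv_Cons nc_monom_eval_Cons)
      then have "G l i \<pi> \<otimes> b (i l) \<otimes> ?w \<pi> l = G l i \<pi> \<otimes> (b (i l) \<otimes> x (\<pi> l)) \<otimes> ?w \<pi> (Suc l)"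
        using Gc b[OF il] x w by (simp add: m_assoc)
      also have "\<dots> = (\<Oplus>h\<in>{..<r}. G l i \<pi> \<otimes> (M (\<pi> l) (i l) h \<otimes> b h) \<otimes> ?w \<pi> (Suc l))"
        unfolding bx[OF il] using Gc b CR MC[OF il] w
        by (simp add: finsum_rdistr finsum_ldistr Pi_iff)
      finally have "sgn_of \<pi> \<otimes> (G l i \<pi> \<otimes> b (i l) \<otimes> ?w \<pi> l) =
          (\<Oplus>h\<in>{..<r}. sgn_of \<pi> \<otimes> (G l i \<pi> \<otimes> (M (\<pi> l) (i l) h \<otimes> b h) \<otimes> ?w \<pi> (Suc l)))"
        using Gc b CR MC[OF il] w by (simp add: finsum_rdistr Pi_iff)
      also have "\<dots> = (\<Oplus>h\<in>{..<r}. ?f \<pi> h)"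
      proof (rule finsum_cong'[OF refl])
        show "?f \<pi> \<in> {..<r} \<rightarrow> carrier R" using f by auto
        fix h assume "h \<in> {..<r}"
        then have h: "h < r" by simp
        show "sgn_of \<pi> \<otimes> (G l i \<pi> \<otimes> (M (\<pi> l) (i l) h \<otimes> b h) \<otimes> ?w \<pi> (Suc l)) = ?f \<pi> h"
          unfolding G_Suc[OF i h] using Gc b[OF h] CR[OF MC[OF il h]] w by (simp add: m_assoc)
      qed
      finally show "sgn_of \<pi> \<otimes> (G l i \<pi> \<otimes> b (i l) \<otimes> ?w \<pi> l) = (\<Oplus>h\<in>{..<r}. ?f \<pi> h)" .
    qed
    also have "\<dots> = (\<Oplus>h\<in>{..<r}. \<Oplus>\<pi>\<in>?P. ?f \<pi> h)"
      by (rule finsum_swap[OF finP]) (use f in auto)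
    also have "\<dots> = (\<Oplus>h\<in>{..<r}. T (Suc l) (i(Suc l := h)))"
      by (simp add: T_def)
    also have "\<dots> = (\<Oplus>h\<in>{..<r}. \<zero>)"
    proof (rule finsum_cong'[OF refl])
      fix h assume "h \<in> {..<r}"
      then show "T (Suc l) (i(Suc l := h)) = \<zero>"
        using step.hyps(3)[of "i(Suc l := h)"] upd[of h] by blast
    qed simp
    finally show ?case by simp
  qed
  define S where "S = nc_poly_eval R x (standard_poly p)"
  have S: "S = (\<Oplus>\<pi>\<in>?P. sgn_of \<pi> \<otimes> ?w \<pi> 0)"
    unfolding S_def by (rule nc_poly_eval_standard_poly[OF x])
  have Sc: "S \<in> carrier R" unfolding S using w by (auto simp: Pi_iff)
  have bS: "b j \<otimes> S = \<zero>" if j: "j < r" for j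
  proof -
    have "b j \<otimes> S = (\<Oplus>\<pi>\<in>?P. b j \<otimes> (sgn_of \<pi> \<otimes> ?w \<pi> 0))"
      unfolding S using finP b[OF j] w by (simp add: finsum_rdistr Pi_iff)
    also have "\<dots> = T 0 (\<lambda>_. j)"
      unfolding T_def
    proof (rule finsum_cong'[OF refl])
      show "(\<lambda>\<pi>. sgn_of \<pi> \<otimes> (G 0 (\<lambda>_. j) \<pi> \<otimes> b j \<otimes> ?w \<pi> 0)) \<in> ?P \<rightarrow> carrier R"
        using GC[of 0 "\<lambda>_. j"] CR b[OF j] w j by (auto simp: Pi_iff)
      fix \<pi>
      have "b j \<otimes> (sgn_of \<pi> \<otimes> ?w \<pi> 0) = sgn_of \<pi> \<otimes> (b j \<otimes> ?w \<pi> 0)"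
        using sgn_of_central[OF b[OF j], of \<pi>] b[OF j] w by (simp add: m_assoc[symmetric])
      then show "b j \<otimes> (sgn_of \<pi> \<otimes> ?w \<pi> 0) = sgn_of \<pi> \<otimes> (G 0 (\<lambda>_. j) \<pi> \<otimes> b j \<otimes> ?w \<pi> 0)"
        using b[OF j] by (simp add: G_def)
    qed
    finally show ?thesis using T[of 0 "\<lambda>_. j"] j by simp
  qed
  \<comment> \<open>Every generator kills \<open>S\<close> from the left, and \<open>1\<close> is a
    \<open>C\<close>-combination of the generators.\<close>
  obtain \<gamma> where \<gamma>: "\<gamma> \<in> {..<r} \<rightarrow> C" "\<one> = (\<Oplus>j\<in>{..<r}. \<gamma> j \<otimes> b j)" using gen by blast
  have \<gamma>c: "\<gamma> j \<in> carrier R" if "j < r" for j using \<gamma>(1) CR that by auto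
  have "S = (\<Oplus>j\<in>{..<r}. \<gamma> j \<otimes> b j) \<otimes> S" using Sc \<gamma>(2)[symmetric] by simp
  also have "\<dots> = (\<Oplus>j\<in>{..<r}. \<gamma> j \<otimes> b j \<otimes> S)"
    using Sc \<gamma>c b by (intro finsum_ldistr) auto
  also have "\<dots> = (\<Oplus>j\<in>{..<r}. \<zero>)"
    using Sc \<gamma>c b bS by (intro finsum_cong' refl) (auto simp: m_assoc)
  finally show ?thesis by (simp add: S_def)
qed

end

section \<open>Homomorphic images, and the standard identity as a polynomial identity\<close>

lemma (in ring_hom_ring) hom_nc_monom_eval:
  assumes "\<And>i. x i \<in> carrier R"
  shows "h (nc_monom_eval R x w) = nc_monom_eval S (\<lambda>i. h (x i)) w"
  using assms R.nc_monom_eval_closed[OF assms]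
  by (induct w) (simp_all add: nc_monom_eval_Nil nc_monom_eval_Cons)

lemma (in ring_hom_ring) hom_standard_poly:
  assumes x: "\<And>i. x i \<in> carrier R"
  shows "h (nc_poly_eval R x (standard_poly p)) = nc_poly_eval S (\<lambda>i. h (x i)) (standard_poly p)"
proof -
  have sgn: "h (R.sgn_of \<pi>) = S.sgn_of \<pi>" for \<pi>
    by (simp add: R.sgn_of_def S.sgn_of_def)
  show ?thesis
    using R.nc_monom_eval_closed[OF x]
    by (simp add: R.nc_poly_eval_standard_poly[OF x] S.nc_poly_eval_standard_poly x Pi_iff o_def sgn hom_nc_monom_eval[OF x])
qed

lemma (in ring) standard_poly_PI:
  assumes "\<And>x. (\<And>i. x i \<in> carrier R) \<Longrightarrow> nc_poly_eval R x (standard_poly p) = \<zero>"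
  shows "PI_ring R"
  unfolding PI_ring_def
proof (intro conjI exI[of _ "standard_poly p"] bexI[of _ "map id [0..<p]"] ballI ring_axioms)
  have id: "id permutes {..<p}" by (rule permutes_id)
  show "Poly_Mapping.lookup (standard_poly p) (map id [0..<p]) = 1"
    using lookup_standard_poly[OF id] by simp
  show "map id [0..<p] \<in> Poly_Mapping.keys (standard_poly p)"
    unfolding keys_standard_poly using id by blast
  show "length v \<le> length (map id [0..<p])" if "v \<in> Poly_Mapping.keys (standard_poly p)" for v
    using that by (auto simp: keys_standard_poly)
qed (use assms in auto)

text \<open>The double centraliser of \<open>x\<close> stands in for the polynomials in
  \<open>x\<close>: it contains \<open>x\<close> and all central elements. It is commutative because
  its elements commute with \<open>x\<close> and so are among the elements with which all its
  members must commute.\<close>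

lemma (in ring) subcring_bicommutant:
  assumes x: "x \<in> carrier R"
  shows "subcring {c \<in> carrier R. \<forall>y\<in>carrier R. x \<otimes> y = y \<otimes> x \<longrightarrow> c \<otimes> y = y \<otimes> c} R"
proof (rule subcringI)
  let ?C = "{c \<in> carrier R. \<forall>y\<in>carrier R. x \<otimes> y = y \<otimes> x \<longrightarrow> c \<otimes> y = y \<otimes> c}"
  show "subring ?C R"
  proof (rule subringI)
    show "?C \<subseteq> carrier R" "\<one> \<in> ?C" by auto
    show "\<ominus> c \<in> ?C" if "c \<in> ?C" for c
      using that by (auto simp: l_minus r_minus)
    show "c \<oplus> d \<in> ?C" if "c \<in> ?C" "d \<in> ?C" for c d
      using that by (auto simp: l_distr r_distr)
    show "c \<otimes> d \<in> ?C" if "c \<in> ?C" "d \<in> ?C" for c d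
    proof -
      have "c \<otimes> d \<otimes> y = y \<otimes> (c \<otimes> d)" if "y \<in> carrier R" "x \<otimes> y = y \<otimes> x" for y
      proof -
        have cy: "c \<otimes> y = y \<otimes> c" "d \<otimes> y = y \<otimes> d" and cd: "c \<in> carrier R" "d \<in> carrier R"
          using \<open>c \<in> ?C\<close> \<open>d \<in> ?C\<close> that by blast+
        have "c \<otimes> d \<otimes> y = c \<otimes> (y \<otimes> d)" using cd that cy by (simp add: m_assoc)
        also have "\<dots> = y \<otimes> c \<otimes> d" using cd that cy by (simp add: m_assoc[symmetric])
        finally show ?thesis using cd that by (simp add: m_assoc)
      qed
      then show ?thesis using that by simp
    qed
  qed
  show "c \<otimes> d = d \<otimes> c" if "c \<in> ?C" "d \<in> ?C" for c d
  proof -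
    have "c \<otimes> x = x \<otimes> c" using that(1) x by blast
    then show ?thesis using that by auto
  qed
qed

section \<open>The standard identity modulo powers of the ideal\<close>

context finite_codim_ideal
begin

text \<open>A Nakayama argument for the nilpotent action of \<open>x\<close>. With \<open>G\<close>
  the \<open>C\<close>-span of \<open>ws\<close> plus \<open>I^n\<close>, the hypothesis gives
  \<open>R = G + xR\<close>; substituting this into itself gives \<open>R = G + x^i R\<close>, and
  at \<open>i = n\<close> the last summand lies in \<open>I^n\<close>, hence in
  \<open>G\<close>.\<close>

lemma generators_mod_pow:
  assumes x: "x \<in> I" and C: "subring C R" "K \<subseteq> C" "x \<in> C"
    and ws: "set ws \<subseteq> carrier R" "carrier R \<subseteq> span_over ((x <# carrier R) <+> ipow n) ws"
    and y: "y \<in> carrier R"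
  shows "\<exists>\<gamma>\<in>{..<length ws} \<rightarrow> C. \<exists>z\<in>ipow n. y = (\<Oplus>j\<in>{..<length ws}. \<gamma> j \<otimes> ws ! j) \<oplus> z"
proof -
  let ?J = "{..<length ws}"
  define G where "G = {(\<Oplus>j\<in>?J. \<gamma> j \<otimes> ws ! j) \<oplus> z | \<gamma> z. \<gamma> \<in> ?J \<rightarrow> C \<and> z \<in> ipow n}"
  note Cd = subringE[OF C(1)]
  note V = right_idealD[OF pow_right_ideal[of n]]
  have CR: "c \<in> carrier R" if "c \<in> C" for c using Cd(1) that by blast
  have xc: "x \<in> carrier R" using x Icarr by blast
  have w: "ws ! j \<in> carrier R" if "j < length ws" for j using ws(1) nth_mem[OF that] by blast
  have fc: "(\<lambda>j. \<gamma> j \<otimes> ws ! j) \<in> ?J \<rightarrow> carrier R" if "\<gamma> \<in> ?J \<rightarrow> C" for \<gamma>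
    using that w CR by (auto simp: Pi_iff)
  have sumc: "(\<Oplus>j\<in>?J. \<gamma> j \<otimes> ws ! j) \<in> carrier R" if "\<gamma> \<in> ?J \<rightarrow> C" for \<gamma>
    using fc[OF that] by simp
  have Gc: "g \<in> carrier R" if "g \<in> G" for g
    using that sumc V(1) by (auto simp: G_def)
  have zero_sum: "(\<Oplus>j\<in>?J. \<zero> \<otimes> ws ! j) = \<zero>"
  proof -
    have "(\<Oplus>j\<in>?J. \<zero> \<otimes> ws ! j) = (\<Oplus>j\<in>?J. \<zero>)" using w by (intro finsum_cong' refl) auto
    then show ?thesis by simp
  qed
  have G_pow: "z \<in> G" if "z \<in> ipow n" for z
  proof -
    have "z = (\<Oplus>j\<in>?J. \<zero> \<otimes> ws ! j) \<oplus> z" using zero_sum that V(1) by (simp add: subset_iff)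
    then show ?thesis
      unfolding G_def using that Cd(2) by (intro CollectI exI[of _ "\<lambda>_. \<zero>"] exI[of _ z]) auto
  qed
  have G_add: "g \<oplus> g' \<in> G" if g: "g \<in> G" "g' \<in> G" for g g'
  proof -
    obtain \<gamma> z \<gamma>' z' where *: "\<gamma> \<in> ?J \<rightarrow> C" "z \<in> ipow n" "g = (\<Oplus>j\<in>?J. \<gamma> j \<otimes> ws ! j) \<oplus> z"
      "\<gamma>' \<in> ?J \<rightarrow> C" "z' \<in> ipow n" "g' = (\<Oplus>j\<in>?J. \<gamma>' j \<otimes> ws ! j) \<oplus> z'"
      using g unfolding G_def by blast
    have zc: "z \<in> carrier R" "z' \<in> carrier R" using * V(1) by auto
    have "(\<Oplus>j\<in>?J. (\<gamma> j \<oplus> \<gamma>' j) \<otimes> ws ! j) = (\<Oplus>j\<in>?J. \<gamma> j \<otimes> ws ! j \<oplus> \<gamma>' j \<otimes> ws ! j)"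
      using *(1,4) w CR by (intro finsum_cong' refl) (auto simp: Pi_iff l_distr)
    also have "\<dots> = (\<Oplus>j\<in>?J. \<gamma> j \<otimes> ws ! j) \<oplus> (\<Oplus>j\<in>?J. \<gamma>' j \<otimes> ws ! j)"
      by (rule finsum_addf[OF fc[OF *(1)] fc[OF *(4)]])
    finally have "g \<oplus> g' = (\<Oplus>j\<in>?J. (\<gamma> j \<oplus> \<gamma>' j) \<otimes> ws ! j) \<oplus> (z \<oplus> z')"
      using *(3,6) sumc[OF *(1)] sumc[OF *(4)] zc by (simp add: a_ac)
    moreover have "(\<lambda>j. \<gamma> j \<oplus> \<gamma>' j) \<in> ?J \<rightarrow> C" using *(1,4) Cd(7) by (auto simp: Pi_iff)
    ultimately show ?thesis
      unfolding G_def using V(3)[OF *(2,5)]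
      by (intro CollectI exI[of _ "\<lambda>j. \<gamma> j \<oplus> \<gamma>' j"] exI[of _ "z \<oplus> z'"]) simp
  qed
  have G_mult: "c \<otimes> g \<in> G" if c: "c \<in> C" and g: "g \<in> G" for c g
  proof -
    obtain \<gamma> z where *: "\<gamma> \<in> ?J \<rightarrow> C" "z \<in> ipow n" "g = (\<Oplus>j\<in>?J. \<gamma> j \<otimes> ws ! j) \<oplus> z"
      using g unfolding G_def by blast
    have zc: "z \<in> carrier R" using * V(1) by auto
    have "c \<otimes> (\<Oplus>j\<in>?J. \<gamma> j \<otimes> ws ! j) = (\<Oplus>j\<in>?J. c \<otimes> (\<gamma> j \<otimes> ws ! j))"
      by (rule finsum_rdistr[OF finite_lessThan CR[OF c] fc[OF *(1)]])
    also have "\<dots> = (\<Oplus>j\<in>?J. (c \<otimes> \<gamma> j) \<otimes> ws ! j)"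
      using *(1) w CR c by (intro finsum_cong' refl) (auto simp: Pi_iff m_assoc)
    finally have "c \<otimes> g = (\<Oplus>j\<in>?J. (c \<otimes> \<gamma> j) \<otimes> ws ! j) \<oplus> c \<otimes> z"
      using *(3) sumc[OF *(1)] zc CR[OF c] by (simp add: r_distr)
    moreover have "(\<lambda>j. c \<otimes> \<gamma> j) \<in> ?J \<rightarrow> C" using *(1) Cd(6) c by (auto simp: Pi_iff)
    moreover have "c \<otimes> z \<in> ipow n" using ideal.I_l_closed[OF pow_ideal *(2) CR[OF c]] .
    ultimately show ?thesis
      unfolding G_def by (intro CollectI exI[of _ "\<lambda>j. c \<otimes> \<gamma> j"] exI[of _ "c \<otimes> z"]) simp
  qed
  have G_ws: "v \<in> G" if "v \<in> set ws" for v
  proof -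
    obtain i where i: "i < length ws" "v = ws ! i" using \<open>v \<in> set ws\<close> by (auto simp: in_set_conv_nth)
    let ?\<gamma> = "\<lambda>j. if j = i then \<one> else \<zero>"
    have "(\<Oplus>j\<in>?J. ?\<gamma> j \<otimes> ws ! j) = (\<Oplus>j\<in>?J. if i = j then ws ! j else \<zero>)"
      using w by (intro finsum_cong' refl) auto
    also have "\<dots> = v" using finsum_singleton[of i ?J "\<lambda>j. ws ! j"] i w by auto
    finally have "v = (\<Oplus>j\<in>?J. ?\<gamma> j \<otimes> ws ! j) \<oplus> \<zero>" using i w by simp
    moreover have "?\<gamma> \<in> ?J \<rightarrow> C" using Cd(2,3) by auto
    ultimately show ?thesis
      unfolding G_def using V(2) by (intro CollectI exI[of _ ?\<gamma>] exI[of _ \<zero>]) simp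
  qed
  define H where "H i = {g \<oplus> x [^] (i::nat) \<otimes> r | g r. g \<in> G \<and> r \<in> carrier R}" for i
  have H1: "r \<in> H 1" if "r \<in> carrier R" for r
  proof -
    have "span_over ((x <# carrier R) <+> ipow n) ws \<subseteq> H 1"
    proof (rule span_over_least)
      show "(x <# carrier R) <+> ipow n \<subseteq> H 1"
      proof
        fix v assume "v \<in> (x <# carrier R) <+> ipow n"
        then obtain r z where *: "r \<in> carrier R" "z \<in> ipow n" "v = x \<otimes> r \<oplus> z"
          unfolding mem_set_add_l_coset_iff by blast
        then have "v = z \<oplus> x [^] (1::nat) \<otimes> r" using xc V(1) by (auto simp: a_comm)
        then show "v \<in> H 1" unfolding H_def using G_pow *(1,2) by blast
      qed
    next
      fix u v assume "u \<in> H 1" "v \<in> H 1"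
      then obtain g r g' r' where *: "g \<in> G" "r \<in> carrier R" "u = g \<oplus> x [^] (1::nat) \<otimes> r"
        "g' \<in> G" "r' \<in> carrier R" "v = g' \<oplus> x [^] (1::nat) \<otimes> r'"
        unfolding H_def by blast
      then have "u \<oplus> v = (g \<oplus> g') \<oplus> x [^] (1::nat) \<otimes> (r \<oplus> r')"
        using xc Gc by (simp add: r_distr a_ac)
      then show "u \<oplus> v \<in> H 1" unfolding H_def using G_add * by blast
    next
      fix c v assume cv: "c \<in> K" "v \<in> set ws"
      then have "c \<otimes> v \<in> G" using G_mult G_ws C(2) by blast
      moreover have "c \<otimes> v = c \<otimes> v \<oplus> x [^] (1::nat) \<otimes> \<zero>"
        using Gc[OF \<open>c \<otimes> v \<in> G\<close>] xc by simp
      ultimately show "c \<otimes> v \<in> H 1" unfolding H_def by blast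
    qed
    then show ?thesis using ws(2) that by blast
  qed
  have xi: "x [^] i \<in> C" for i :: nat by (induct i) (use Cd(3,6) C(3) in auto)
  have "r \<in> H i" if "r \<in> carrier R" for r i
    using that
  proof (induct i arbitrary: r)
    case 0
    have "\<zero> \<in> G" using G_pow V(2) by blast
    moreover have "r = \<zero> \<oplus> x [^] (0::nat) \<otimes> r" using 0 by simp
    ultimately show ?case unfolding H_def using 0 by blast
  next
    case (Suc i)
    obtain g r1 where 1: "g \<in> G" "r1 \<in> carrier R" "r = g \<oplus> x [^] i \<otimes> r1"
      using Suc unfolding H_def by blast
    obtain g' r2 where 2: "g' \<in> G" "r2 \<in> carrier R" "r1 = g' \<oplus> x [^] (1::nat) \<otimes> r2"
      using H1[OF 1(2)] unfolding H_def by blast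
    have "r = (g \<oplus> x [^] i \<otimes> g') \<oplus> x [^] Suc i \<otimes> r2"
      using 1 2 xc Gc[OF 1(1)] Gc[OF 2(1)] by (simp add: r_distr a_assoc m_assoc)
    moreover have "g \<oplus> x [^] i \<otimes> g' \<in> G" using G_add[OF 1(1) G_mult[OF xi 2(1)]] .
    ultimately show ?case unfolding H_def using 2(2) by blast
  qed
  then obtain g r where *: "g \<in> G" "r \<in> carrier R" "y = g \<oplus> x [^] n \<otimes> r"
    using y unfolding H_def by blast
  have "x [^] n \<otimes> r \<in> ipow n" using V(6)[OF nat_pow_mem[OF x] *(2)] .
  then have "y \<in> G" using G_add[OF *(1) G_pow] *(3) by simp
  then show ?thesis unfolding G_def by blast
qed

text \<open>The double centraliser of \<open>x\<close> maps to a commutative subring of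
  \<open>R/I^n\<close>, over which the cosets of \<open>ws\<close> generate, so
  \<open>standard_identity\<close> applies in the quotient and its vanishing value pulls back to
  membership in \<open>I^n\<close>.\<close>

lemma standard_poly_mod_pow:
  assumes x: "x \<in> I" and b: "b * b < p"
    and ws: "set ws \<subseteq> carrier R" "length ws \<le> b"
      "carrier R \<subseteq> span_over ((x <# carrier R) <+> ipow n) ws"
    and a: "\<And>i. a i \<in> carrier R"
  shows "nc_poly_eval R a (standard_poly p) \<in> ipow n"
proof -
  let ?V = "ipow n" and ?l = "length ws"
  interpret V: ideal ?V R by (rule pow_ideal)
  let ?S = "R Quot ?V" and ?h = "(+>) ?V"
  interpret S: ring ?S by (rule V.quotient_is_ring)
  interpret h: ring_hom_ring R ?S ?h
    by (rule ring_hom_ringI2[OF ring_axioms S.ring_axioms V.rcos_ring_hom])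
  have S0: "\<zero>\<^bsub>?S\<^esub> = ?V" unfolding FactRing_def ring.simps ..
  have h_zero: "?h z = \<zero>\<^bsub>?S\<^esub>" if "z \<in> ?V" for z
    unfolding S0 by (rule a_rcos_zero[OF pow_ideal that])
  have h_zeroD: "z \<in> ?V" if "?h z = \<zero>\<^bsub>?S\<^esub>" "z \<in> carrier R" for z
    using V.a_rcos_self[OF that(2)] unfolding that(1)[unfolded S0] .
  have h_surj: "\<exists>y\<in>carrier R. Y = ?h y" if "Y \<in> carrier ?S" for Y
    using that unfolding FactRing_def partial_object.simps A_RCOSETS_def' by blast
  define C where "C = {c \<in> carrier R. \<forall>y\<in>carrier R. x \<otimes> y = y \<otimes> x \<longrightarrow> c \<otimes> y = y \<otimes> c}"
  have xc: "x \<in> carrier R" using x Icarr by blast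
  have C: "subcring C R" unfolding C_def by (rule subcring_bicommutant[OF xc])
  have Cs: "subring C R" using C by (rule subcring.axioms)
  have CR: "C \<subseteq> carrier R" by (rule subringE(1)[OF Cs])
  have KC: "K \<subseteq> C" using central K_carr by (auto simp: C_def)
  have xC: "x \<in> C" using xc by (simp add: C_def)
  have hC: "subcring (?h ` C) ?S"
  proof (rule S.subcringI[OF h.img_is_subring[OF Cs]])
    fix u v assume "u \<in> ?h ` C" "v \<in> ?h ` C"
    then obtain c d where cd: "c \<in> C" "d \<in> C" "u = ?h c" "v = ?h d" by blast
    have "c \<otimes> d = d \<otimes> c" using C cd(1,2) by (simp add: subcring_def subcring_axioms_def)
    moreover have "c \<in> carrier R" "d \<in> carrier R" using CR cd by auto
    ultimately show "u \<otimes>\<^bsub>?S\<^esub> v = v \<otimes>\<^bsub>?S\<^esub> u"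
      unfolding cd(3,4) by (metis h.hom_mult)
  qed
  have w: "ws ! j \<in> carrier R" if "j < ?l" for j using ws(1) nth_mem[OF that] by blast
  have "nc_poly_eval ?S (\<lambda>i. ?h (a i)) (standard_poly p) = \<zero>\<^bsub>?S\<^esub>"
  proof (rule S.standard_identity[OF hC])
    show "?h (ws ! j) \<in> carrier ?S" if "j < ?l" for j using w[OF that] by simp
    show "?l * ?l < p" using b ws(2) mult_le_mono[of ?l b ?l b] by simp
    show "?h (a i) \<in> carrier ?S" for i using a by simp
    fix Y assume "Y \<in> carrier ?S"
    then obtain y where y: "y \<in> carrier R" "Y = ?h y" using h_surj by blast
    obtain \<gamma> z where *: "\<gamma> \<in> {..<?l} \<rightarrow> C" "z \<in> ?V" "y = (\<Oplus>j\<in>{..<?l}. \<gamma> j \<otimes> ws ! j) \<oplus> z"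
      using generators_mod_pow[OF x Cs KC xC ws(1,3) y(1)] by blast
    have \<gamma>c: "\<gamma> j \<in> carrier R" if "j < ?l" for j using *(1) CR that by auto
    have fc: "(\<lambda>j. \<gamma> j \<otimes> ws ! j) \<in> {..<?l} \<rightarrow> carrier R" using \<gamma>c w by simp
    have "Y = ?h (\<Oplus>j\<in>{..<?l}. \<gamma> j \<otimes> ws ! j) \<oplus>\<^bsub>?S\<^esub> ?h z"
      unfolding y(2) *(3) using fc pow_carr[OF *(2)] by (intro h.hom_add) auto
    also have "\<dots> = ?h (\<Oplus>j\<in>{..<?l}. \<gamma> j \<otimes> ws ! j)"
      unfolding h_zero[OF *(2)] by (rule S.r_zero[OF h.hom_closed[OF finsum_closed[OF fc]]])
    also have "\<dots> = (\<Oplus>\<^bsub>?S\<^esub>j\<in>{..<?l}. ?h (\<gamma> j \<otimes> ws ! j))"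
      using h.hom_finsum[OF fc] by (simp add: o_def)
    also have "\<dots> = (\<Oplus>\<^bsub>?S\<^esub>j\<in>{..<?l}. ?h (\<gamma> j) \<otimes>\<^bsub>?S\<^esub> ?h (ws ! j))"
      using \<gamma>c w by (intro S.finsum_cong' refl) (auto intro: h.hom_mult)
    finally have "Y = (\<Oplus>\<^bsub>?S\<^esub>j\<in>{..<?l}. ?h (\<gamma> j) \<otimes>\<^bsub>?S\<^esub> ?h (ws ! j))" .
    moreover have "(\<lambda>j. ?h (\<gamma> j)) \<in> {..<?l} \<rightarrow> ?h ` C" using *(1) by auto
    ultimately show "\<exists>\<gamma>\<in>{..<?l} \<rightarrow> ?h ` C. Y = (\<Oplus>\<^bsub>?S\<^esub>j\<in>{..<?l}. \<gamma> j \<otimes>\<^bsub>?S\<^esub> ?h (ws ! j))"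
      by (intro bexI[of _ "\<lambda>j. ?h (\<gamma> j)"])
  qed
  then have "?h (nc_poly_eval R a (standard_poly p)) = \<zero>\<^bsub>?S\<^esub>"
    using h.hom_standard_poly[OF a] by simp
  moreover have "nc_poly_eval R a (standard_poly p) \<in> carrier R"
    unfolding nc_poly_eval_standard_poly[OF a]
    using nc_monom_eval_closed[of a, OF a] by (intro finsum_closed) auto
  ultimately show ?thesis by (rule h_zeroD)
qed

text \<open>The bound \<open>b\<close> serves all \<open>n\<close> at once, so a single polynomial
  takes its values in every power of \<open>I\<close>, and these powers intersect in zero.\<close>

lemma PI_ring_of_cancellable:
  assumes prime: "prime_ring R" and left: "left_noetherian R" and right: "right_noetherian R"
    and proper: "I \<noteq> carrier R"
    and x: "x \<in> I" "\<And>y. \<lbrakk>y \<in> carrier R; x \<otimes> y = \<zero>\<rbrakk> \<Longrightarrow> y = \<zero>"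
  shows "PI_ring R"
proof -
  obtain b where b: "\<And>n. \<exists>ws. set ws \<subseteq> carrier R \<and> length ws \<le> b \<and>
      carrier R \<subseteq> span_over ((x <# carrier R) <+> ipow n) ws"
    using span_mod_cancellable[OF right Icarr[OF x(1)] x(2)] by blast
  show ?thesis
  proof (rule standard_poly_PI[of "Suc (b * b)"])
    fix a :: "nat \<Rightarrow> 'a" assume a: "\<And>i. a i \<in> carrier R"
    have "nc_poly_eval R a (standard_poly (Suc (b * b))) \<in> ipow n" for n
    proof -
      obtain ws where "set ws \<subseteq> carrier R" "length ws \<le> b"
        "carrier R \<subseteq> span_over ((x <# carrier R) <+> ipow n) ws" using b by blast
      then show ?thesis by (intro standard_poly_mod_pow[OF x(1) lessI _ _ _ a])
    qed
    then show "nc_poly_eval R a (standard_poly (Suc (b * b))) = \<zero>"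
      using Inter_pow_eq_zero[OF prime left right proper] by blast
  qed
qed

end


section \<open>Invertible ideals of algebras\<close>

text \<open>The products \<open>u q\<close> with \<open>q\<close> in \<open>J\<close> are admissible
  first factors: \<open>I J = R\<close> puts \<open>I^(n+1) J\<close> inside \<open>I^n\<close>, and
  \<open>J I = R\<close> puts \<open>(u q) c = u (q c)\<close> into \<open>uR\<close>. Expanding
  \<open>u 1\<close> with \<open>1\<close> in \<open>J I\<close> gives the decomposition, and
  injectivity of \<open>\<iota>\<close> brings the equalities from \<open>Q\<close> back to
  \<open>R\<close>.\<close>

lemma invertible_ideal_divide:
  assumes hom: "ring_hom_ring R Q \<iota>" and inj: "inj_on \<iota> (carrier R)"
    and I: "ideal I R" and J: "J \<subseteq> carrier Q"
    and IJ: "ideal_prod Q (\<iota> ` I) J = \<iota> ` carrier R"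
    and JI: "ideal_prod Q J (\<iota> ` I) = \<iota> ` carrier R"
  shows "dividing_ideal I R"
proof -
  interpret h: ring_hom_ring R Q \<iota> by (rule hom)
  interpret I: ideal I R by (rule I)
  show ?thesis
  proof (intro dividing_ideal.intro I dividing_ideal_axioms.intro)
    fix n u assume u: "u \<in> I.ipow (Suc n)"
    have uc: "u \<in> carrier R" by (rule I.pow_carr[OF u])
    define A where "A = {r \<in> I.ipow n. \<forall>c\<in>I. r \<otimes>\<^bsub>R\<^esub> c \<in> u <#\<^bsub>R\<^esub> carrier R}"
    have lift: "\<exists>r\<in>I.ipow n. \<iota> v \<otimes>\<^bsub>Q\<^esub> q = \<iota> r"
      if v: "v \<in> ideal_prod R (I.ipow n) I" and q: "q \<in> J" for v q
      using v
    proof induct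
      case (prod a c)
      have qc: "q \<in> carrier Q" using q J by blast
      have "\<iota> c \<otimes>\<^bsub>Q\<^esub> q \<in> \<iota> ` carrier R"
        unfolding IJ[symmetric] using prod(2) q by (intro ideal_prod.prod) auto
      then obtain t where t: "t \<in> carrier R" "\<iota> c \<otimes>\<^bsub>Q\<^esub> q = \<iota> t" by blast
      have "\<iota> (a \<otimes>\<^bsub>R\<^esub> c) \<otimes>\<^bsub>Q\<^esub> q = \<iota> (a \<otimes>\<^bsub>R\<^esub> t)"
        using I.pow_carr[OF prod(1)] I.Icarr[OF prod(2)] t qc by (simp add: h.S.m_assoc)
      moreover have "a \<otimes>\<^bsub>R\<^esub> t \<in> I.ipow n"
        using ideal.I_r_closed[OF I.pow_ideal prod(1) t(1)] .
      ultimately show ?case by blast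
    next
      case (sum s1 s2)
      then obtain r1 r2 where r: "r1 \<in> I.ipow n" "\<iota> s1 \<otimes>\<^bsub>Q\<^esub> q = \<iota> r1"
        "r2 \<in> I.ipow n" "\<iota> s2 \<otimes>\<^bsub>Q\<^esub> q = \<iota> r2" by blast
      have sc: "s1 \<in> carrier R" "s2 \<in> carrier R"
        using sum I.pow_carr[of _ "Suc n"] by auto
      have "\<iota> (s1 \<oplus>\<^bsub>R\<^esub> s2) \<otimes>\<^bsub>Q\<^esub> q = \<iota> (r1 \<oplus>\<^bsub>R\<^esub> r2)"
        using r sc q J I.pow_carr[OF r(1)] I.pow_carr[OF r(3)] by (auto simp: h.S.l_distr)
      moreover have "r1 \<oplus>\<^bsub>R\<^esub> r2 \<in> I.ipow n"
        using h.R.right_idealD(3)[OF I.pow_right_ideal r(1,3)] .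
      ultimately show ?case by blast
    qed
    have quotient: "\<exists>r\<in>A. \<iota> u \<otimes>\<^bsub>Q\<^esub> q = \<iota> r" if q: "q \<in> J" for q
    proof -
      obtain r where r: "r \<in> I.ipow n" "\<iota> u \<otimes>\<^bsub>Q\<^esub> q = \<iota> r" using lift[OF _ q] u by auto
      have rc: "r \<in> carrier R" by (rule I.pow_carr[OF r(1)])
      have "r \<otimes>\<^bsub>R\<^esub> c \<in> u <#\<^bsub>R\<^esub> carrier R" if c: "c \<in> I" for c
      proof -
        have "q \<otimes>\<^bsub>Q\<^esub> \<iota> c \<in> \<iota> ` carrier R"
          unfolding JI[symmetric] using c q by (intro ideal_prod.prod) auto
        then obtain t where t: "t \<in> carrier R" "q \<otimes>\<^bsub>Q\<^esub> \<iota> c = \<iota> t" by blast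
        have cc: "c \<in> carrier R" by (rule I.Icarr[OF c])
        have "\<iota> (r \<otimes>\<^bsub>R\<^esub> c) = (\<iota> u \<otimes>\<^bsub>Q\<^esub> q) \<otimes>\<^bsub>Q\<^esub> \<iota> c" using rc cc r(2) by simp
        also have "\<dots> = \<iota> u \<otimes>\<^bsub>Q\<^esub> \<iota> t"
          using uc cc q J t(2) by (subst h.S.m_assoc) auto
        also have "\<dots> = \<iota> (u \<otimes>\<^bsub>R\<^esub> t)" using uc t(1) by simp
        finally have "r \<otimes>\<^bsub>R\<^esub> c = u \<otimes>\<^bsub>R\<^esub> t"
          using inj_onD[OF inj] rc cc uc t(1) by simp
        then show ?thesis using t(1) by (auto simp: mem_l_coset_iff)
      qed
      then show ?thesis using r by (auto simp: A_def)
    qed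
    have AR: "A \<subseteq> carrier R" using I.pow_carr by (auto simp: A_def)
    have AIc: "z \<in> carrier R" if "z \<in> ideal_prod R A I" for z
      using that by induct (use AR I.Icarr in auto)
    have "\<exists>z\<in>ideal_prod R A I. \<iota> u \<otimes>\<^bsub>Q\<^esub> w = \<iota> z" if "w \<in> ideal_prod Q J (\<iota> ` I)" for w
      using that
    proof induct
      case (prod q c')
      then obtain c where c: "c \<in> I" "c' = \<iota> c" by blast
      obtain r where r: "r \<in> A" "\<iota> u \<otimes>\<^bsub>Q\<^esub> q = \<iota> r" using quotient[OF prod(1)] by blast
      have rc: "r \<in> carrier R" "c \<in> carrier R" using r AR c I.Icarr by auto
      have "\<iota> u \<otimes>\<^bsub>Q\<^esub> (q \<otimes>\<^bsub>Q\<^esub> c') = (\<iota> u \<otimes>\<^bsub>Q\<^esub> q) \<otimes>\<^bsub>Q\<^esub> \<iota> c"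
        using uc prod(1) J c rc by (subst h.S.m_assoc) auto
      also have "\<dots> = \<iota> (r \<otimes>\<^bsub>R\<^esub> c)" using r rc by simp
      finally show ?case using ideal_prod.prod[OF r(1) c(1), of R] by blast
    next
      case (sum w1 w2)
      then obtain z1 z2 where z: "z1 \<in> ideal_prod R A I" "\<iota> u \<otimes>\<^bsub>Q\<^esub> w1 = \<iota> z1"
        "z2 \<in> ideal_prod R A I" "\<iota> u \<otimes>\<^bsub>Q\<^esub> w2 = \<iota> z2" by blast
      have wc: "w1 \<in> carrier Q" "w2 \<in> carrier Q" using sum(1,3) unfolding JI by auto
      have "\<iota> u \<otimes>\<^bsub>Q\<^esub> (w1 \<oplus>\<^bsub>Q\<^esub> w2) = \<iota> (z1 \<oplus>\<^bsub>R\<^esub> z2)"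
        using z wc uc AIc[OF z(1)] AIc[OF z(3)] by (simp add: h.S.r_distr)
      then show ?case using ideal_prod.sum[OF z(1,3)] by blast
    qed
    moreover have "\<one>\<^bsub>Q\<^esub> \<in> ideal_prod Q J (\<iota> ` I)"
      unfolding JI using h.hom_one h.R.one_closed by force
    ultimately obtain z where z: "z \<in> ideal_prod R A I" "\<iota> u \<otimes>\<^bsub>Q\<^esub> \<one>\<^bsub>Q\<^esub> = \<iota> z" by blast
    have "\<iota> u = \<iota> z" using z(2) uc by simp
    then have "u = z" using uc AIc[OF z(1)] by (rule inj_onD[OF inj])
    then show "u \<in> ideal_prod R {r \<in> I.ipow n. \<forall>c\<in>I. r \<otimes>\<^bsub>R\<^esub> c \<in> u <#\<^bsub>R\<^esub> carrier R} I"
      using z(1) by (simp add: A_def)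
  qed
qed

section \<open>Regular elements in an invertible ideal\<close>

lemma regular_element_mult:
  fixes R (structure)
  assumes "ring R" "regular_element R s" "regular_element R t"
  shows "regular_element R (s \<otimes>\<^bsub>R\<^esub> t)"
proof -
  interpret ring R by (rule assms(1))
  have c: "s \<in> carrier R" "t \<in> carrier R" using assms(2,3) unfolding regular_element_def by blast+
  show ?thesis
    unfolding regular_element_def
  proof (intro conjI ballI impI)
    show "s \<otimes> t \<in> carrier R" using c by simp
    show "r = \<zero>" if "r \<in> carrier R" "s \<otimes> t \<otimes> r = \<zero>" for r
    proof -
      have "s \<otimes> (t \<otimes> r) = \<zero>" using that c by (simp add: m_assoc)
      then have "t \<otimes> r = \<zero>"
        using assms(2) m_closed[OF c(2) that(1)] unfolding regular_element_def by blast
      then show ?thesis using assms(3) that(1) unfolding regular_element_def by blast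
    qed
    show "r = \<zero>" if "r \<in> carrier R" "r \<otimes> (s \<otimes> t) = \<zero>" for r
    proof -
      have "r \<otimes> s \<otimes> t = \<zero>" using that c by (simp add: m_assoc)
      then have "r \<otimes> s = \<zero>"
        using assms(3) m_closed[OF that(1) c(1)] unfolding regular_element_def by blast
      then show ?thesis using assms(2) that(1) unfolding regular_element_def by blast
    qed
  qed
qed

text \<open>
  A common denominator of the \<open>q\<^sub>i\<close> in \<open>1 = \<Sum> c\<^sub>i q\<^sub>i\<close>, with \<open>c\<^sub>i \<in> I\<close> and \<open>q\<^sub>i \<in> I\<^bsup>-1\<^esup>\<close>, lies in \<open>I\<close>.
\<close>
lemma invertible_ideal_regular_element:
  assumes Q: "classical_quotient_ring R Q \<iota>" and I: "ideal I R" and J: "J \<subseteq> carrier Q"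
    and IJ: "ideal_prod Q (\<iota> ` I) J = \<iota> ` carrier R"
  shows "\<exists>s\<in>I. regular_element R s"
proof -
  have R: "ring R" and Qr: "ring Q" and hom: "\<iota> \<in> ring_hom R Q" and inj: "inj_on \<iota> (carrier R)"
    and unit: "\<And>s. regular_element R s \<Longrightarrow> \<iota> s \<in> Units Q"
    and frac: "\<And>q. q \<in> carrier Q \<Longrightarrow>
      \<exists>r\<in>carrier R. \<exists>s. regular_element R s \<and> q = \<iota> r \<otimes>\<^bsub>Q\<^esub> inv\<^bsub>Q\<^esub> (\<iota> s)"
    using Q by (auto simp: classical_quotient_ring_def)
  interpret h: ring_hom_ring R Q \<iota> by (rule ring_hom_ringI2[OF R Qr hom])
  interpret I: ideal I R by (rule I)
  have reg_carr: "s \<in> carrier R" if "regular_element R s" for s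
    using that by (simp add: regular_element_def)
  have frac': "\<exists>r\<in>carrier R. \<exists>s. regular_element R s \<and> q \<otimes>\<^bsub>Q\<^esub> \<iota> s = \<iota> r" if q: "q \<in> carrier Q" for q
  proof -
    obtain r s where rs: "r \<in> carrier R" "regular_element R s" "q = \<iota> r \<otimes>\<^bsub>Q\<^esub> inv\<^bsub>Q\<^esub> (\<iota> s)"
      using frac[OF q] by blast
    have "q \<otimes>\<^bsub>Q\<^esub> \<iota> s = \<iota> r"
      using rs unit[OF rs(2)] reg_carr by (simp add: h.S.m_assoc)
    then show ?thesis using rs by blast
  qed
  \<comment> \<open>Stated for every \<open>w\<close> in \<open>I J\<close>, so that induction on
    sums is possible; the case of interest is \<open>w = 1\<close>.\<close>
  have "\<exists>s a. regular_element R s \<and> a \<in> I \<and> w \<otimes>\<^bsub>Q\<^esub> \<iota> s = \<iota> a" if "w \<in> ideal_prod Q (\<iota> ` I) J" for w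
    using that
  proof induct
    case (prod c' q)
    then obtain c where c: "c \<in> I" "c' = \<iota> c" by blast
    have q: "q \<in> carrier Q" using prod(2) J by blast
    obtain r s where rs: "r \<in> carrier R" "regular_element R s" "q \<otimes>\<^bsub>Q\<^esub> \<iota> s = \<iota> r" using frac'[OF q] by blast
    have "c' \<otimes>\<^bsub>Q\<^esub> q \<otimes>\<^bsub>Q\<^esub> \<iota> s = \<iota> (c \<otimes>\<^bsub>R\<^esub> r)"
      using c rs q I.Icarr[OF c(1)] reg_carr by (simp add: h.S.m_assoc)
    then show ?case using rs(2) I.I_r_closed[OF c(1) rs(1)] by blast
  next
    case (sum w1 w2)
    then obtain s1 a1 s2 a2 where *: "regular_element R s1" "a1 \<in> I" "w1 \<otimes>\<^bsub>Q\<^esub> \<iota> s1 = \<iota> a1"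
      "regular_element R s2" "a2 \<in> I" "w2 \<otimes>\<^bsub>Q\<^esub> \<iota> s2 = \<iota> a2" by blast
    have wc: "w1 \<in> carrier Q" "w2 \<in> carrier Q" using sum(1,3) unfolding IJ by auto
    have sc: "s1 \<in> carrier R" "s2 \<in> carrier R" using * reg_carr by auto
    have ac: "a1 \<in> carrier R" "a2 \<in> carrier R" using * I.Icarr by auto
    have u1: "inv\<^bsub>Q\<^esub> (\<iota> s1) \<in> carrier Q" "\<iota> s1 \<otimes>\<^bsub>Q\<^esub> inv\<^bsub>Q\<^esub> (\<iota> s1) = \<one>\<^bsub>Q\<^esub>" using unit[OF *(1)] by auto
    \<comment> \<open>Writing \<open>s1^-1 s2\<close> as a right fraction \<open>r s^-1\<close>
      produces the common right multiple \<open>s1 r = s2 s\<close>: the Ore condition, read off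
      from \<open>Q\<close>.\<close>
    then obtain r s where rs: "r \<in> carrier R" "regular_element R s"
      "inv\<^bsub>Q\<^esub> (\<iota> s1) \<otimes>\<^bsub>Q\<^esub> \<iota> s2 \<otimes>\<^bsub>Q\<^esub> \<iota> s = \<iota> r"
      using frac'[of "inv\<^bsub>Q\<^esub> (\<iota> s1) \<otimes>\<^bsub>Q\<^esub> \<iota> s2"] sc by auto
    have s: "s \<in> carrier R" using reg_carr rs(2) .
    have "\<iota> s1 \<otimes>\<^bsub>Q\<^esub> \<iota> r = (\<iota> s1 \<otimes>\<^bsub>Q\<^esub> inv\<^bsub>Q\<^esub> (\<iota> s1)) \<otimes>\<^bsub>Q\<^esub> (\<iota> s2 \<otimes>\<^bsub>Q\<^esub> \<iota> s)"
      using u1(1) sc s by (simp add: rs(3)[symmetric] h.S.m_assoc)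
    then have eq: "\<iota> s1 \<otimes>\<^bsub>Q\<^esub> \<iota> r = \<iota> s2 \<otimes>\<^bsub>Q\<^esub> \<iota> s" using u1(2) sc s by simp
    have "w1 \<otimes>\<^bsub>Q\<^esub> (\<iota> s2 \<otimes>\<^bsub>Q\<^esub> \<iota> s) = \<iota> (a1 \<otimes>\<^bsub>R\<^esub> r)"
      unfolding eq[symmetric] using wc sc rs(1) ac *(3) by (simp add: h.S.m_assoc[symmetric])
    moreover have "w2 \<otimes>\<^bsub>Q\<^esub> (\<iota> s2 \<otimes>\<^bsub>Q\<^esub> \<iota> s) = \<iota> (a2 \<otimes>\<^bsub>R\<^esub> s)"
      using wc sc s ac *(6) by (simp add: h.S.m_assoc[symmetric])
    ultimately have "(w1 \<oplus>\<^bsub>Q\<^esub> w2) \<otimes>\<^bsub>Q\<^esub> \<iota> (s2 \<otimes>\<^bsub>R\<^esub> s) = \<iota> (a1 \<otimes>\<^bsub>R\<^esub> r \<oplus>\<^bsub>R\<^esub> a2 \<otimes>\<^bsub>R\<^esub> s)"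
      using wc sc s ac rs(1) by (simp add: h.S.l_distr)
    moreover have "a1 \<otimes>\<^bsub>R\<^esub> r \<oplus>\<^bsub>R\<^esub> a2 \<otimes>\<^bsub>R\<^esub> s \<in> I"
      using *(2,5) rs(1) s by (intro I.a_closed I.I_r_closed)
    ultimately show ?case using regular_element_mult[OF R *(4) rs(2)] by blast
  qed
  moreover have "\<one>\<^bsub>Q\<^esub> \<in> ideal_prod Q (\<iota> ` I) J"
    unfolding IJ using h.hom_one h.R.one_closed by force
  ultimately obtain s a where sa: "regular_element R s" "a \<in> I" "\<one>\<^bsub>Q\<^esub> \<otimes>\<^bsub>Q\<^esub> \<iota> s = \<iota> a" by blast
  have "s = a" using sa reg_carr[OF sa(1)] I.Icarr[OF sa(2)] inj_onD[OF inj] by simp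
  then show ?thesis using sa by blast
qed

section \<open>Scalars from \<open>k\<close> and finite codimension\<close>

lemma (in assoc_algebra) central_subfield_scalars:
  assumes "\<one> \<noteq> \<zero>"
  shows "central_subfield ((\<lambda>c. c \<odot> \<one>) ` carrier k) R"
proof -
  let ?h = "\<lambda>c. c \<odot> \<one>"
  have "?h \<in> ring_hom k R"
    by (rule ring_hom_memI) (simp_all add: smult_l_distr smult_assoc1 smult_mult_left)
  then interpret h: ring_hom_ring k R ?h
    by (intro ring_hom_ringI2 A.ring_axioms K.ring_axioms)
  have "subfield (?h ` carrier k) R"
    using h.img_is_subfield(2)[OF K.carrier_is_subfield assms] .
  then show ?thesis
    by (intro central_subfield.intro A.ring_axioms central_subfield_axioms.intro)
      (auto simp: smult_mult_left smult_mult_right)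
qed

text \<open>Representatives of a base of \<open>R/N\<close> span \<open>R\<close> modulo
  \<open>N\<close>: if the coset of \<open>y\<close> is a scalar coset times that of
  \<open>u\<close> plus \<open>e\<close>, and \<open>c\<close> represents the scalar, then
  \<open>y - c u\<close> represents \<open>e\<close>. This removes one generator at a time until the
  remainder lies in \<open>N\<close>.\<close>

lemma (in assoc_algebra) span_over_of_finite_codimension:
  assumes one: "\<one> \<noteq> \<zero>" and N: "ideal N R" "N \<noteq> carrier R" and fin: "finite_codimension k R N"
  shows "\<exists>us. set us \<subseteq> carrier R \<and>
    carrier R \<subseteq> central_subfield.span_over ((\<lambda>c. c \<odot> \<one>) ` carrier k) R N us"
proof -
  let ?K = "(\<lambda>c. c \<odot> \<one>) ` carrier k"
  interpret C: central_subfield ?K R by (rule central_subfield_scalars[OF one])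
  interpret N: ideal N R by (rule N(1))
  let ?S = "R Quot N" and ?h = "(+>) N"
  interpret S: ring ?S by (rule N.quotient_is_ring)
  interpret h: ring_hom_ring R ?S ?h
    by (rule ring_hom_ringI2[OF A.ring_axioms S.ring_axioms N.rcos_ring_hom])
  let ?L = "scalars_mod k R N"
  have L: "subfield ?L ?S" by (rule subfield_scalars_mod[OF N])
  have LK: "?L = ?h ` ?K" by (auto simp: scalars_mod_def)
  have h_surj: "\<exists>y\<in>carrier R. Y = ?h y" if "Y \<in> carrier ?S" for Y
    using that unfolding FactRing_def partial_object.simps A_RCOSETS_def' by blast
  obtain n where "S.dimension n ?L (carrier ?S)"
    using fin unfolding finite_codimension_def S.finite_dimension_def by blast
  then obtain Us where Us: "set Us \<subseteq> carrier ?S" "S.Span ?L Us = carrier ?S"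
    using S.exists_base[OF L] by blast
  have "\<exists>us. set us \<subseteq> carrier R \<and> Us = map ?h us"
    using Us(1)
  proof (induct Us)
    case (Cons U Us)
    then obtain us u where "set us \<subseteq> carrier R" "Us = map ?h us" "u \<in> carrier R" "U = ?h u"
      using h_surj[of U] by auto
    then show ?case by (intro exI[of _ "u # us"]) simp
  qed simp
  then obtain us where us: "set us \<subseteq> carrier R" "Us = map ?h us" by blast
  have "y \<in> C.span_over N us"
    if "?h y \<in> S.Span ?L (map ?h us)" "y \<in> carrier R" "set us \<subseteq> carrier R" for y us
    using that
  proof (induct us arbitrary: y)
    case Nil
    moreover have "\<zero>\<^bsub>?S\<^esub> = N" unfolding FactRing_def ring.simps ..
    ultimately have "?h y = N" by simp
    then show ?case using N.a_rcos_self[OF Nil(2)] by simp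
  next
    case (Cons u us)
    have u: "u \<in> carrier R" "set us \<subseteq> carrier R" using Cons.prems by auto
    have "?h y \<in> S.line_extension ?L (?h u) (S.Span ?L (map ?h us))" using Cons.prems(1) by simp
    then obtain l e where le: "l \<in> ?L" "e \<in> S.Span ?L (map ?h us)"
      "?h y = l \<otimes>\<^bsub>?S\<^esub> ?h u \<oplus>\<^bsub>?S\<^esub> e"
      unfolding S.line_extension_mem_iff by blast
    obtain c where c: "c \<in> ?K" "l = ?h c" using le(1)[unfolded LK] by (rule imageE)
    have cc: "c \<in> carrier R" by (rule C.K_carr[OF c(1)])
    have "S.Span ?L (map ?h us) \<subseteq> carrier ?S"
    proof (rule S.Span_in_carrier[OF subfieldE(3)[OF L]])
      show "set (map ?h us) \<subseteq> carrier ?S"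
        unfolding set_map by (rule image_subsetI[OF h.hom_closed[OF subsetD[OF u(2)]]])
    qed
    then have ec: "e \<in> carrier ?S" using le(2) by blast
    have "?h (y \<ominus> c \<otimes> u) = ?h y \<ominus>\<^bsub>?S\<^esub> l \<otimes>\<^bsub>?S\<^esub> ?h u"
      using Cons.prems(2) cc u(1) c(2) by (simp add: a_minus_def)
    also have "\<dots> = e"
      unfolding le(3) using ec cc u(1) c(2)
      by (simp add: a_minus_def S.a_ac S.r_neg)
    finally have "?h (y \<ominus> c \<otimes> u) = e" .
    then have "y \<ominus> c \<otimes> u \<in> C.span_over N us"
      using Cons.hyps[of "y \<ominus> c \<otimes> u"] le(2) Cons.prems(2) cc u by simp
    moreover have "y = (y \<ominus> c \<otimes> u) \<oplus> c \<otimes> u"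
      using Cons.prems(2) cc u(1) by (simp add: a_minus_def a_assoc l_neg)
    ultimately show ?case using c(1) by auto
  qed
  then have "carrier R \<subseteq> C.span_over N us"
    using us Us(2) h.hom_closed by blast
  then show ?thesis using us(1) by blast
qed

theorem theorem2:
  fixes k :: "('c, 'm) ring_scheme"
    and R :: "('c, 'a, 'n) module_scheme"
    and Q :: "('b, 'p) ring_scheme"
    and \<iota> :: "'a \<Rightarrow> 'b"
    and N :: "'a set"
  assumes "assoc_algebra k R"
    and "prime_ring R"
    and "left_noetherian R" and "right_noetherian R"
    and "classical_quotient_ring R Q \<iota>"
    and "invertible_ideal R Q \<iota> N" and "N \<noteq> carrier R"
    and "finite_codimension k R N"
  shows "PI_ring R"
proof -
  interpret assoc_algebra k R by (rule assms(1))
  have one: "\<one>\<^bsub>R\<^esub> \<noteq> \<zero>\<^bsub>R\<^esub>" using assms(2) by (simp add: prime_ring_def)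
  have hom: "ring_hom_ring R Q \<iota>" and inj: "inj_on \<iota> (carrier R)"
    using assms(5) by (auto simp: classical_quotient_ring_def intro: ring_hom_ringI2)
  obtain J where N: "ideal N R" and sub: "subbimodule R Q \<iota> J"
    and J: "ideal_prod Q (\<iota> ` N) J = \<iota> ` carrier R" "ideal_prod Q J (\<iota> ` N) = \<iota> ` carrier R"
    using assms(6) unfolding invertible_ideal_def by blast
  have JQ: "J \<subseteq> carrier Q" using sub by (auto simp: subbimodule_def dest: additive_subgroup.a_Hcarr)
  let ?K = "(\<lambda>c. c \<odot>\<^bsub>R\<^esub> \<one>\<^bsub>R\<^esub>) ` carrier k"
  obtain us where us: "set us \<subseteq> carrier R" "carrier R \<subseteq> central_subfield.span_over ?K R N us"
    using span_over_of_finite_codimension[OF one N assms(7,8)] by blast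
  interpret finite_codim_ideal ?K N R us
    by (intro finite_codim_ideal.intro finite_codim_ideal_axioms.intro
        central_subfield_scalars[OF one] invertible_ideal_divide[OF hom inj N JQ J] us)
  obtain s where s: "s \<in> N" "regular_element R s"
    using invertible_ideal_regular_element[OF assms(5) N JQ J(1)] by blast
  show ?thesis
    using s(2) unfolding regular_element_def
    by (intro PI_ring_of_cancellable[OF assms(2,3,4,7) s(1)]) blast
qed

end
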